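(* Let $\{\tau_k\}\downarrow0$ and $\{\epsilon_k\}\downarrow0$ be sequences of positive numbers with $\epsilon_k=O(\tau_k^2)$. Assume that the MPEC-MFCQ holds for problem (P) (at its feasible points). Let $\{v^k\}$ be a sequence generated by Algorithm GRLPN (described in the context), where in each outer iteration $k$ the inner loop is stopped with the criterion $\|F_{\tau_k}(\tilde z^j)\|_\infty\le\epsilon_k$. Then any accumulation point $v^*$ of the sequence $\{v^k\}$ is a C-stationary point of (P).
   Context: **Problem (P).** Let $K,m_1,m_2,n$ be positive integers, $[N]:=\{1,\dots,N\}$, and let $\mathbf 1$ denote an all-ones vector. For each fold $t=1,\dots,K$ of a $K$-fold cross-validation there are $m_2$ training points and $m_1$ validation points $(x,y)$ with $x\in\mathbb{R}^n$ and label $y\in\{\pm1\}$. Let $B^t\in\mathbb{R}^{m_2\times n}$ be the matrix whose rows are $y\,x^\top$ over the training points of fold $t$, and $A^t\in\mathbb{R}^{m_1\times n}$ the matrix whose rows are $y\,x^\top$ over the validation points of fold $t$. Let $B=\mathrm{diag}(B^1,\dots,B^K)$ and $A=\mathrm{diag}(A^1,\dots,A^K)$ (block diagonal), and let $E_K^n\in\mathbb{R}^{Kn\times n}$ be $K$ copies of $I_n$ stacked vertically. Let $C_{lb},C_{ub}\in\mathbb{R}_+$, $\overline w_{lb},\overline w_{ub}\in\mathbb{R}^n_+$ be given bounds. Put $\overline n=1+n$, $\overline m=2K(m_1+m_2+n)$. The variable is $v=[C,\overline w^\top,\zeta^\top,z^\top,\alpha^\top,\xi^\top,\beta^\top,\gamma^\top]^\top\in\mathbb{R}^{\overline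 n+\overline m}$ with $C\in\mathbb{R}$, $\overline w\in\mathbb{R}^n$, $\zeta,z\in\mathbb{R}^{Km_1}$, $\alpha,\xi\in\mathbb{R}^{Km_2}$, $\beta,\gamma\in\mathbb{R}^{Kn}$. Problem (P) is $$\min_v f(v)\quad\text{s.t.}\quad g(v)\ge\mathbf 0,\quad \mathbf 0\le H(v)\perp G(v)\ge\mathbf 0,$$ with $f(v)=\frac1{Km_1}\mathbf 1^\top\zeta$, $g(v)=(C_{ub}-C,\ C-C_{lb},\ \overline w_{ub}-\overline w,\ \overline w-\overline w_{lb})\in\mathbb{R}^{2\overline n}$, $H(v)=(\zeta,z,\alpha,\xi,\beta,\gamma)\in\mathbb{R}^{\overline m}$, and $$G(v)=\begin{pmatrix}AB^\top\alpha+A\beta-A\gamma+z\\ \mathbf 1-\zeta\\ BB^\top\alpha+B\beta-B\gamma-\mathbf 1+\xi\\ \mathbf 1C-\alpha\\ B^\top\alpha+\beta-\gamma+E_K^n\overline w\\ -B^\top\alpha-\beta+\gamma+E_K^n\overline w\end{pmatrix}\in\mathbb{R}^{\overline m}.$$ **Relaxed KKT system.** For $\tau>0$ and $\lambda=(\lambda^g,\lambda^G,\lambda^H,\lambda^{GH})\in\mathbb{R}^{2\overline n}\times\mathbb{R}^{\overline m}\times\mathbb{R}^{\overline m}\times\mathbb{R}^{\overline m}$ let $$L(v,\lambda)=f(v)-\sum_i\lambda^g_ig_i(v)-\sum_i\lambda^G_iG_i(v)-\sum_i\lambda^H_iH_i(v)+\sum_i\lambda^{GH}_i[G_i(v)H_i(v)-\tau].$$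 With $u\in\mathbb{R}^{\overline m}$, $\tilde z=(v,\lambda,u)\in\mathbb{R}^{\overline q}$, $\overline q=3\overline n+5\overline m$, let $$F_\tau(\tilde z)=\begin{pmatrix}\nabla_vL(v,\lambda)\\ u+G(v)H(v)-\tau\mathbf 1\\ \min\{\lambda^g,g(v)\}\\ \min\{\lambda^G,G(v)\}\\ \min\{\lambda^H,H(v)\}\\ \min\{\lambda^{GH},u\}\end{pmatrix},\qquad \tilde\Omega=\{\tilde z:\lambda\ge\mathbf 0,\ u\ge\mathbf 0,\ g(v)\ge\mathbf 0,\ G(v)\ge\mathbf 0,\ H(v)\ge\mathbf 0\},$$ where $G(v)H(v)$ and $\min$ are componentwise. The selection functions of $F_\tau$ are the quadratic maps obtained by replacing each scalar minimum by one of its two arguments; one is active at $\tilde z$ if it coincides with $F_\tau$ at $\tilde z$. **Algorithm GRLPN.** Parameters $\sigma_1,\sigma_2,\theta\in(0,1)$, $\tau_0>0$, initial point $(v^0,\lambda^0,u^0)\in\tilde\Omega$. For $k=0,1,2,\dots$ (outer loop): start the inner loop at $\tilde z^0=(v^k,\lambda^k,u^k)$ with $\tau=\tau_k$. Inner loop, for $j=0,1,\dots$: stop as soon as $\|F_{\tau}(\tilde z^j)\|_\infty\le\epsilon_k$; otherwise, with $\mathcal J(\tilde z^j)\in\partial F_\tau(\tilde z^j)$ (Clarke's generalized Jacobian), selected as the Jacobian of a selection function active at $\tilde z^j$, let $(\eta^j,d^j)$ solve $$\min_{\eta\in\mathbb{R},d\in\mathbb{R}^{\overline q}}\ \eta\quad\text{s.t.}\quad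 \|F_\tau(\tilde z^j)+\mathcal J(\tilde z^j)d\|_\infty\le\eta\|F_\tau(\tilde z^j)\|_\infty^2,\quad \|d\|_\infty\le\eta\|F_\tau(\tilde z^j)\|_\infty,\quad \tilde z^j+d\in\tilde\Omega,$$ let $\Delta_j=-\|F_\tau(\tilde z^j)\|_\infty(1-\eta^j\|F_\tau(\tilde z^j)\|_\infty)$, let $m\ge0$ be the minimal integer with $\|F_\tau(\tilde z^j+\theta^md^j)\|_\infty\le\|F_\tau(\tilde z^j)\|_\infty+\sigma_1\theta^m\Delta_j$, and set $\tilde z^{j+1}=\tilde z^j+\theta^md^j$. When the inner loop stops at $\tilde z^j$ (so $\tilde z^j\in\tilde\Omega$ and $\|F_{\tau_k}(\tilde z^j)\|_\infty\le\epsilon_k$), set $(v^{k+1},\lambda^{k+1},u^{k+1})=\tilde z^j$ and $\tau_{k+1}=\sigma_2\tau_k$. It is assumed that the inner loop stops for every $k$, so an infinite sequence $\{v^k\}$ is generated. **Index sets.** For $v$ feasible for (P): $I_G=\{i\in[\overline m]:G_i(v)=0,H_i(v)>0\}$, $I_{GH}=\{i\in[\overline m]:G_i(v)=0,H_i(v)=0\}$, $I_H=\{i\in[\overline m]:G_i(v)>0,H_i(v)=0\}$, $I_g=\{i\in[2\overline n]:g_i(v)=0\}$. **MPEC-MFCQ.** It holds at a feasible $v$ if the only scalars $\{a_i\}_{i\in I_g},\{b_i\}_{i\in I_{GH}},\{c_i\}_{i\in I_{GH}}$, all $\ge0$, and $\{d_i\}_{i\in I_G},\{e_i\}_{i\in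 I_H}$, real, with $$\sum_{I_g}a_i\nabla g_i(v)+\sum_{I_{GH}}b_i\nabla G_i(v)+\sum_{I_{GH}}c_i\nabla H_i(v)+\sum_{I_G}d_i\nabla G_i(v)+\sum_{I_H}e_i\nabla H_i(v)=\mathbf 0$$ are all zero. **C-stationarity.** A feasible $v$ of (P) is C-stationary if there are $\gamma,\nu\in\mathbb{R}^{\overline m}$ and $\lambda\in\mathbb{R}^{2\overline n}$ with $$\nabla f(v)-\sum_{i=1}^{\overline m}\gamma_i\nabla G_i(v)-\sum_{i=1}^{\overline m}\nu_i\nabla H_i(v)-\sum_{i=1}^{2\overline n}\lambda_i\nabla g_i(v)=\mathbf 0,$$ $\lambda_i\ge0$ and $\lambda_ig_i(v)=0$ for all $i$, $\gamma_i=0$ for $i\in I_H$, $\nu_i=0$ for $i\in I_G$, and $\gamma_i\nu_i\ge0$ for $i\in I_{GH}$. (In this definition $\gamma$ denotes a multiplier, not the $\gamma$-block of the variable.) *)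

theory Defs
  imports "HOL-Analysis.Analysis" "HOL-Library.Landau_Symbols"
begin

section \<open>Gradients and Clarke's generalized Jacobian\<close>

definition grad :: "('a::real_inner \<Rightarrow> real) \<Rightarrow> 'a \<Rightarrow> 'a"
  where "grad \<phi> x = (THE D. GDERIV \<phi> x :> D)"

definition clarke_jacobian ::
    "('a::real_normed_vector \<Rightarrow> 'b::real_normed_vector) \<Rightarrow> 'a \<Rightarrow> ('a \<Rightarrow>\<^sub>L 'b) set"
  where "clarke_jacobian \<Phi> x =
    convex hull {J. \<exists>s D. s \<longlonglongrightarrow> x \<and> D \<longlonglongrightarrow> J \<and>
                      (\<forall>k::nat. (\<Phi> has_derivative blinfun_apply (D k)) (at (s k)))}"


section \<open>Index types\<close>

text \<open>
  The dimensions are cardinalities of finite types: \<open>K = CARD('k)\<close>, \<open>m\<^sub>1 = CARD('m1)\<close>,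
  \<open>m\<^sub>2 = CARD('m2)\<close>, \<open>n = CARD('n)\<close>. A stacked vector in \<open>\<real>\<^sup>K\<^sup>m\<close> is indexed by pairs
  (fold, position in the fold).

  \<open>cix\<close> indexes the \<open>2K(m\<^sub>1+m\<^sub>2+n)\<close> complementarity pairs; each constructor is named after
  the block of \<open>H(v)\<close> it belongs to. \<open>bix\<close> indexes the \<open>2(1+n)\<close> bound constraints and
  \<open>vix\<close> the entries of the variable \<open>v\<close>.
\<close>

datatype ('k, 'm1, 'm2, 'n) cix =
    Ix_zeta "'k \<times> 'm1" | Ix_z "'k \<times> 'm1"
  | Ix_alpha "'k \<times> 'm2" | Ix_xi "'k \<times> 'm2"
  | Ix_beta "'k \<times> 'n" | Ix_gamma "'k \<times> 'n"

datatype 'n bix = C_upper | C_lower | W_upper 'n | W_lower 'n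

datatype ('k, 'm1, 'm2, 'n) vix = Var_C | Var_W 'n | Var_H "('k, 'm1, 'm2, 'n) cix"

instance cix :: (finite, finite, finite, finite) finite
proof
  have "x \<in> range Ix_zeta \<union> range Ix_z \<union> range Ix_alpha \<union> range Ix_xi \<union> range Ix_beta \<union> range Ix_gamma"
    for x :: "('a, 'b, 'c, 'd) cix"
    by (cases x) blast+
  then have "(UNIV :: ('a, 'b, 'c, 'd) cix set) \<subseteq>
      range Ix_zeta \<union> range Ix_z \<union> range Ix_alpha \<union> range Ix_xi \<union> range Ix_beta \<union> range Ix_gamma"
    by blast
  then show "finite (UNIV :: ('a, 'b, 'c, 'd) cix set)"
    by (rule finite_subset) simp
qed

instance bix :: (finite) finite
proof
  have "x \<in> {C_upper, C_lower} \<union> range W_upper \<union> range W_lower" for x :: "'a bix"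
    by (cases x) blast+
  then have "(UNIV :: 'a bix set) \<subseteq> {C_upper, C_lower} \<union> range W_upper \<union> range W_lower"
    by blast
  then show "finite (UNIV :: 'a bix set)"
    by (rule finite_subset) simp
qed

instance vix :: (finite, finite, finite, finite) finite
proof
  have "x \<in> {Var_C} \<union> range Var_W \<union> range Var_H" for x :: "('a, 'b, 'c, 'd) vix"
    by (cases x) blast+
  then have "(UNIV :: ('a, 'b, 'c, 'd) vix set) \<subseteq> {Var_C} \<union> range Var_W \<union> range Var_H"
    by blast
  then show "finite (UNIV :: ('a, 'b, 'c, 'd) vix set)"
    by (rule finite_subset) simp
qed

type_synonym ('k, 'm1, 'm2, 'n) var = "real ^ ('k, 'm1, 'm2, 'n) vix"
type_synonym ('k, 'm1, 'm2, 'n) cvec = "real ^ ('k, 'm1, 'm2, 'n) cix"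
type_synonym 'n bvec = "real ^ 'n bix"


section \<open>Problem (P)\<close>

record ('k, 'm1, 'm2, 'n) svm_data =
  train_x :: "'k \<Rightarrow> 'm2 \<Rightarrow> real ^ 'n"
  train_y :: "'k \<Rightarrow> 'm2 \<Rightarrow> real"
  valid_x :: "'k \<Rightarrow> 'm1 \<Rightarrow> real ^ 'n"
  valid_y :: "'k \<Rightarrow> 'm1 \<Rightarrow> real"
  C_lb :: real
  C_ub :: real
  w_lb :: "real ^ 'n"
  w_ub :: "real ^ 'n"

definition admissible_data :: "('k::finite, 'm1::finite, 'm2::finite, 'n::finite) svm_data \<Rightarrow> bool"
  where "admissible_data P \<longleftrightarrow>
    (\<forall>t i. train_y P t i \<in> {-1, 1}) \<and> (\<forall>t i. valid_y P t i \<in> {-1, 1}) \<and>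
    0 \<le> C_lb P \<and> 0 \<le> C_ub P \<and> 0 \<le> w_lb P \<and> 0 \<le> w_ub P"

definition block_diag :: "('k::finite \<Rightarrow> real ^ 'n ^ 'm) \<Rightarrow> real ^ ('k \<times> 'n) ^ ('k \<times> 'm)"
  where "block_diag M = (\<chi> p q. if fst p = fst q then M (fst p) $ snd p $ snd q else 0)"

definition Amat :: "('k::finite, 'm1::finite, 'm2::finite, 'n::finite) svm_data
    \<Rightarrow> real ^ ('k \<times> 'n) ^ ('k \<times> 'm1)"
  where "Amat P = block_diag (\<lambda>t. \<chi> i. valid_y P t i *\<^sub>R valid_x P t i)"

definition Bmat :: "('k::finite, 'm1::finite, 'm2::finite, 'n::finite) svm_data
    \<Rightarrow> real ^ ('k \<times> 'n) ^ ('k \<times> 'm2)"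
  where "Bmat P = block_diag (\<lambda>t. \<chi> i. train_y P t i *\<^sub>R train_x P t i)"

definition Emat :: "real ^ 'n ^ ('k::finite \<times> 'n::finite)"
  where "Emat = (\<chi> p j. mat 1 $ snd p $ j)"

definition fobj :: "('k::finite, 'm1::finite, 'm2::finite, 'n::finite) var \<Rightarrow> real"
  where "fobj v = 1 / (real CARD('k) * real CARD('m1)) * (\<Sum>p\<in>UNIV. v $ Var_H (Ix_zeta p))"

definition gcon :: "('k::finite, 'm1::finite, 'm2::finite, 'n::finite) svm_data
    \<Rightarrow> ('k, 'm1, 'm2, 'n) var \<Rightarrow> 'n bvec"
  where "gcon P v = (\<chi> i. case i of
      C_upper \<Rightarrow> C_ub P - v $ Var_C
    | C_lower \<Rightarrow> v $ Var_C - C_lb P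
    | W_upper j \<Rightarrow> w_ub P $ j - v $ Var_W j
    | W_lower j \<Rightarrow> v $ Var_W j - w_lb P $ j)"

definition Hcon :: "('k::finite, 'm1::finite, 'm2::finite, 'n::finite) var
    \<Rightarrow> ('k, 'm1, 'm2, 'n) cvec"
  where "Hcon v = (\<chi> i. v $ Var_H i)"

definition Gcon :: "('k::finite, 'm1::finite, 'm2::finite, 'n::finite) svm_data
    \<Rightarrow> ('k, 'm1, 'm2, 'n) var \<Rightarrow> ('k, 'm1, 'm2, 'n) cvec"
  where "Gcon P v = (
    let A = Amat P; B = Bmat P;
        C = v $ Var_C; w = (\<chi> j. v $ Var_W j);
        \<zeta> = (\<chi> p. v $ Var_H (Ix_zeta p)); z = (\<chi> p. v $ Var_H (Ix_z p));
        \<alpha> = (\<chi> p. v $ Var_H (Ix_alpha p)); \<xi> = (\<chi> p. v $ Var_H (Ix_xi p));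
        \<beta> = (\<chi> p. v $ Var_H (Ix_beta p)); \<gamma> = (\<chi> p. v $ Var_H (Ix_gamma p))
    in \<chi> i. case i of
      Ix_zeta p \<Rightarrow> ((A ** transpose B) *v \<alpha> + A *v \<beta> - A *v \<gamma> + z) $ p
    | Ix_z p \<Rightarrow> 1 - \<zeta> $ p
    | Ix_alpha p \<Rightarrow> ((B ** transpose B) *v \<alpha> + B *v \<beta> - B *v \<gamma> - 1 + \<xi>) $ p
    | Ix_xi p \<Rightarrow> C - \<alpha> $ p
    | Ix_beta p \<Rightarrow> (transpose B *v \<alpha> + \<beta> - \<gamma> + Emat *v w) $ p
    | Ix_gamma p \<Rightarrow> (- (transpose B *v \<alpha>) - \<beta> + \<gamma> + Emat *v w) $ p)"

definition feasible :: "('k::finite, 'm1::finite, 'm2::finite, 'n::finite) svm_data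
    \<Rightarrow> ('k, 'm1, 'm2, 'n) var \<Rightarrow> bool"
  where "feasible P v \<longleftrightarrow>
    0 \<le> gcon P v \<and> 0 \<le> Hcon v \<and> 0 \<le> Gcon P v \<and> orthogonal (Hcon v) (Gcon P v)"


section \<open>Constraint qualification and stationarity\<close>

definition I_G :: "('k::finite, 'm1::finite, 'm2::finite, 'n::finite) svm_data
    \<Rightarrow> ('k, 'm1, 'm2, 'n) var \<Rightarrow> ('k, 'm1, 'm2, 'n) cix set"
  where "I_G P v = {i. Gcon P v $ i = 0 \<and> Hcon v $ i > 0}"

definition I_GH :: "('k::finite, 'm1::finite, 'm2::finite, 'n::finite) svm_data
    \<Rightarrow> ('k, 'm1, 'm2, 'n) var \<Rightarrow> ('k, 'm1, 'm2, 'n) cix set"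
  where "I_GH P v = {i. Gcon P v $ i = 0 \<and> Hcon v $ i = 0}"

definition I_H :: "('k::finite, 'm1::finite, 'm2::finite, 'n::finite) svm_data
    \<Rightarrow> ('k, 'm1, 'm2, 'n) var \<Rightarrow> ('k, 'm1, 'm2, 'n) cix set"
  where "I_H P v = {i. Gcon P v $ i > 0 \<and> Hcon v $ i = 0}"

definition I_g :: "('k::finite, 'm1::finite, 'm2::finite, 'n::finite) svm_data
    \<Rightarrow> ('k, 'm1, 'm2, 'n) var \<Rightarrow> 'n bix set"
  where "I_g P v = {i. gcon P v $ i = 0}"

definition MPEC_MFCQ :: "('k::finite, 'm1::finite, 'm2::finite, 'n::finite) svm_data
    \<Rightarrow> ('k, 'm1, 'm2, 'n) var \<Rightarrow> bool"
  where "MPEC_MFCQ P v \<longleftrightarrow>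
    (\<forall>a b c d e.
      (\<forall>i\<in>I_g P v. a i \<ge> 0) \<and> (\<forall>i\<in>I_GH P v. b i \<ge> 0) \<and> (\<forall>i\<in>I_GH P v. c i \<ge> 0) \<and>
      (\<Sum>i\<in>I_g P v. a i *\<^sub>R grad (\<lambda>x. gcon P x $ i) v)
      + (\<Sum>i\<in>I_GH P v. b i *\<^sub>R grad (\<lambda>x. Gcon P x $ i) v)
      + (\<Sum>i\<in>I_GH P v. c i *\<^sub>R grad (\<lambda>x. Hcon x $ i) v)
      + (\<Sum>i\<in>I_G P v. d i *\<^sub>R grad (\<lambda>x. Gcon P x $ i) v)
      + (\<Sum>i\<in>I_H P v. e i *\<^sub>R grad (\<lambda>x. Hcon x $ i) v) = 0
      \<longrightarrow> (\<forall>i\<in>I_g P v. a i = 0) \<and> (\<forall>i\<in>I_GH P v. b i = 0) \<and> (\<forall>i\<in>I_GH P v. c i = 0)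
        \<and> (\<forall>i\<in>I_G P v. d i = 0) \<and> (\<forall>i\<in>I_H P v. e i = 0))"

definition C_stationary :: "('k::finite, 'm1::finite, 'm2::finite, 'n::finite) svm_data
    \<Rightarrow> ('k, 'm1, 'm2, 'n) var \<Rightarrow> bool"
  where "C_stationary P v \<longleftrightarrow> feasible P v \<and>
    (\<exists>(\<gamma> :: ('k, 'm1, 'm2, 'n) cvec) (\<nu> :: ('k, 'm1, 'm2, 'n) cvec) (\<mu> :: 'n bvec).
      grad fobj v
        - (\<Sum>i\<in>UNIV. \<gamma> $ i *\<^sub>R grad (\<lambda>x. Gcon P x $ i) v)
        - (\<Sum>i\<in>UNIV. \<nu> $ i *\<^sub>R grad (\<lambda>x. Hcon x $ i) v)
        - (\<Sum>i\<in>UNIV. \<mu> $ i *\<^sub>R grad (\<lambda>x. gcon P x $ i) v) = 0 \<and>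
      (\<forall>i. \<mu> $ i \<ge> 0 \<and> \<mu> $ i * gcon P v $ i = 0) \<and>
      (\<forall>i\<in>I_H P v. \<gamma> $ i = 0) \<and> (\<forall>i\<in>I_G P v. \<nu> $ i = 0) \<and>
      (\<forall>i\<in>I_GH P v. \<gamma> $ i * \<nu> $ i \<ge> 0))"


section \<open>The relaxed KKT system\<close>

text \<open>Multipliers \<open>(\<lambda>\<^sup>g, \<lambda>\<^sup>G, \<lambda>\<^sup>H, \<lambda>\<^sup>G\<^sup>H)\<close>, primal-dual points \<open>(v, \<lambda>, u)\<close>, and the range of \<open>F\<^sub>\<tau>\<close>.\<close>

type_synonym ('k, 'm1, 'm2, 'n) mult =
  "'n bvec \<times> ('k, 'm1, 'm2, 'n) cvec \<times> ('k, 'm1, 'm2, 'n) cvec \<times> ('k, 'm1, 'm2, 'n) cvec"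

type_synonym ('k, 'm1, 'm2, 'n) pdpoint =
  "('k, 'm1, 'm2, 'n) var \<times> ('k, 'm1, 'm2, 'n) mult \<times> ('k, 'm1, 'm2, 'n) cvec"

type_synonym ('k, 'm1, 'm2, 'n) residual =
  "('k, 'm1, 'm2, 'n) var \<times> ('k, 'm1, 'm2, 'n) cvec \<times> 'n bvec \<times> ('k, 'm1, 'm2, 'n) cvec
    \<times> ('k, 'm1, 'm2, 'n) cvec \<times> ('k, 'm1, 'm2, 'n) cvec"

fun Lagr :: "('k::finite, 'm1::finite, 'm2::finite, 'n::finite) svm_data \<Rightarrow> real
    \<Rightarrow> ('k, 'm1, 'm2, 'n) var \<Rightarrow> ('k, 'm1, 'm2, 'n) mult \<Rightarrow> real"
  where "Lagr P \<tau> v (lg, lG, lH, lGH) =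
    fobj v - (\<Sum>i\<in>UNIV. lg $ i * gcon P v $ i)
      - (\<Sum>i\<in>UNIV. lG $ i * Gcon P v $ i) - (\<Sum>i\<in>UNIV. lH $ i * Hcon v $ i)
      + (\<Sum>i\<in>UNIV. lGH $ i * (Gcon P v $ i * Hcon v $ i - \<tau>))"

fun Fmap :: "('k::finite, 'm1::finite, 'm2::finite, 'n::finite) svm_data \<Rightarrow> real
    \<Rightarrow> ('k, 'm1, 'm2, 'n) pdpoint \<Rightarrow> ('k, 'm1, 'm2, 'n) residual"
  where "Fmap P \<tau> (v, (lg, lG, lH, lGH), u) =
    (grad (\<lambda>x. Lagr P \<tau> x (lg, lG, lH, lGH)) v,
     \<chi> i. u $ i + Gcon P v $ i * Hcon v $ i - \<tau>,
     \<chi> i. min (lg $ i) (gcon P v $ i),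
     \<chi> i. min (lG $ i) (Gcon P v $ i),
     \<chi> i. min (lH $ i) (Hcon v $ i),
     \<chi> i. min (lGH $ i) (u $ i))"

text \<open>
  A selection function of \<open>F\<^sub>\<tau>\<close> is given by one set of indices per block of minima:
  the first argument is selected on the set and the second one off it.
\<close>

fun Fsel :: "('k::finite, 'm1::finite, 'm2::finite, 'n::finite) svm_data \<Rightarrow> real
    \<Rightarrow> 'n bix set \<Rightarrow> ('k, 'm1, 'm2, 'n) cix set \<Rightarrow> ('k, 'm1, 'm2, 'n) cix set
    \<Rightarrow> ('k, 'm1, 'm2, 'n) cix set
    \<Rightarrow> ('k, 'm1, 'm2, 'n) pdpoint \<Rightarrow> ('k, 'm1, 'm2, 'n) residual"
  where "Fsel P \<tau> Sg SG SH SGH (v, (lg, lG, lH, lGH), u) =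
    (grad (\<lambda>x. Lagr P \<tau> x (lg, lG, lH, lGH)) v,
     \<chi> i. u $ i + Gcon P v $ i * Hcon v $ i - \<tau>,
     \<chi> i. if i \<in> Sg then lg $ i else gcon P v $ i,
     \<chi> i. if i \<in> SG then lG $ i else Gcon P v $ i,
     \<chi> i. if i \<in> SH then lH $ i else Hcon v $ i,
     \<chi> i. if i \<in> SGH then lGH $ i else u $ i)"

definition Omega :: "('k::finite, 'm1::finite, 'm2::finite, 'n::finite) svm_data
    \<Rightarrow> ('k, 'm1, 'm2, 'n) pdpoint set"
  where "Omega P = {(v, (lg, lG, lH, lGH), u).
    0 \<le> lg \<and> 0 \<le> lG \<and> 0 \<le> lH \<and> 0 \<le> lGH \<and> 0 \<le> u \<and>
    0 \<le> gcon P v \<and> 0 \<le> Gcon P v \<and> 0 \<le> Hcon v}"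


section \<open>Algorithm GRLPN\<close>

definition admissible_jacobian :: "('k::finite, 'm1::finite, 'm2::finite, 'n::finite) svm_data
    \<Rightarrow> real \<Rightarrow> ('k, 'm1, 'm2, 'n) pdpoint
    \<Rightarrow> (('k, 'm1, 'm2, 'n) pdpoint \<Rightarrow>\<^sub>L ('k, 'm1, 'm2, 'n) residual) \<Rightarrow> bool"
  where "admissible_jacobian P \<tau> z J \<longleftrightarrow>
    J \<in> clarke_jacobian (Fmap P \<tau>) z \<and>
    (\<exists>Sg SG SH SGH. Fsel P \<tau> Sg SG SH SGH z = Fmap P \<tau> z \<and>
       (Fsel P \<tau> Sg SG SH SGH has_derivative blinfun_apply J) (at z))"

definition lp_feasible :: "('k::finite, 'm1::finite, 'm2::finite, 'n::finite) svm_data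
    \<Rightarrow> real \<Rightarrow> ('k, 'm1, 'm2, 'n) pdpoint
    \<Rightarrow> (('k, 'm1, 'm2, 'n) pdpoint \<Rightarrow>\<^sub>L ('k, 'm1, 'm2, 'n) residual)
    \<Rightarrow> real \<Rightarrow> ('k, 'm1, 'm2, 'n) pdpoint \<Rightarrow> bool"
  where "lp_feasible P \<tau> z J \<eta> d \<longleftrightarrow>
    infnorm (Fmap P \<tau> z + blinfun_apply J d) \<le> \<eta> * (infnorm (Fmap P \<tau> z))\<^sup>2 \<and>
    infnorm d \<le> \<eta> * infnorm (Fmap P \<tau> z) \<and>
    z + d \<in> Omega P"

definition lp_solution :: "('k::finite, 'm1::finite, 'm2::finite, 'n::finite) svm_data
    \<Rightarrow> real \<Rightarrow> ('k, 'm1, 'm2, 'n) pdpoint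
    \<Rightarrow> (('k, 'm1, 'm2, 'n) pdpoint \<Rightarrow>\<^sub>L ('k, 'm1, 'm2, 'n) residual)
    \<Rightarrow> real \<Rightarrow> ('k, 'm1, 'm2, 'n) pdpoint \<Rightarrow> bool"
  where "lp_solution P \<tau> z J \<eta> d \<longleftrightarrow>
    lp_feasible P \<tau> z J \<eta> d \<and> (\<forall>\<eta>' d'. lp_feasible P \<tau> z J \<eta>' d' \<longrightarrow> \<eta> \<le> \<eta>')"

definition sufficient_decrease :: "('k::finite, 'm1::finite, 'm2::finite, 'n::finite) svm_data
    \<Rightarrow> real \<Rightarrow> real \<Rightarrow> real \<Rightarrow> ('k, 'm1, 'm2, 'n) pdpoint \<Rightarrow> real
    \<Rightarrow> ('k, 'm1, 'm2, 'n) pdpoint \<Rightarrow> nat \<Rightarrow> bool"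
  where "sufficient_decrease P \<sigma>1 \<theta> \<tau> z \<eta> d m \<longleftrightarrow>
    (let \<Delta> = - infnorm (Fmap P \<tau> z) * (1 - \<eta> * infnorm (Fmap P \<tau> z))
     in infnorm (Fmap P \<tau> (z + \<theta> ^ m *\<^sub>R d)) \<le> infnorm (Fmap P \<tau> z) + \<sigma>1 * \<theta> ^ m * \<Delta>)"

definition inner_step :: "('k::finite, 'm1::finite, 'm2::finite, 'n::finite) svm_data
    \<Rightarrow> real \<Rightarrow> real \<Rightarrow> real \<Rightarrow> ('k, 'm1, 'm2, 'n) pdpoint \<Rightarrow> ('k, 'm1, 'm2, 'n) pdpoint \<Rightarrow> bool"
  where "inner_step P \<sigma>1 \<theta> \<tau> z z' \<longleftrightarrow>
    (\<exists>J \<eta> d m. admissible_jacobian P \<tau> z J \<and> lp_solution P \<tau> z J \<eta> d \<and>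
       sufficient_decrease P \<sigma>1 \<theta> \<tau> z \<eta> d m \<and>
       (\<forall>m'<m. \<not> sufficient_decrease P \<sigma>1 \<theta> \<tau> z \<eta> d m') \<and>
       z' = z + \<theta> ^ m *\<^sub>R d)"

definition inner_loop :: "('k::finite, 'm1::finite, 'm2::finite, 'n::finite) svm_data
    \<Rightarrow> real \<Rightarrow> real \<Rightarrow> real \<Rightarrow> real
    \<Rightarrow> ('k, 'm1, 'm2, 'n) pdpoint \<Rightarrow> ('k, 'm1, 'm2, 'n) pdpoint \<Rightarrow> bool"
  where "inner_loop P \<sigma>1 \<theta> \<tau> \<epsilon> z z' \<longleftrightarrow>
    (\<exists>(s :: nat \<Rightarrow> ('k, 'm1, 'm2, 'n) pdpoint) N. s 0 = z \<and> s N = z' \<and>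
       (\<forall>j<N. \<not> infnorm (Fmap P \<tau> (s j)) \<le> \<epsilon> \<and> inner_step P \<sigma>1 \<theta> \<tau> (s j) (s (Suc j))) \<and>
       infnorm (Fmap P \<tau> (s N)) \<le> \<epsilon>)"

text \<open>
  \<open>z k\<close> is the outer iterate \<open>(v\<^sup>k, \<lambda>\<^sup>k, u\<^sup>k)\<close>. Since \<open>inner_loop\<close> describes terminating
  runs only, an infinite sequence \<open>z\<close> exists only if every inner loop stops.
\<close>

definition GRLPN :: "('k::finite, 'm1::finite, 'm2::finite, 'n::finite) svm_data
    \<Rightarrow> real \<Rightarrow> real \<Rightarrow> real \<Rightarrow> real \<Rightarrow> (nat \<Rightarrow> real) \<Rightarrow> (nat \<Rightarrow> real)
    \<Rightarrow> (nat \<Rightarrow> ('k, 'm1, 'm2, 'n) pdpoint) \<Rightarrow> bool"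
  where "GRLPN P \<sigma>1 \<sigma>2 \<theta> \<tau>0 \<tau> \<epsilon> z \<longleftrightarrow>
    \<sigma>1 \<in> {0<..<1} \<and> \<sigma>2 \<in> {0<..<1} \<and> \<theta> \<in> {0<..<1} \<and> 0 < \<tau>0 \<and>
    z 0 \<in> Omega P \<and> \<tau> 0 = \<tau>0 \<and>
    (\<forall>k. inner_loop P \<sigma>1 \<theta> (\<tau> k) (\<epsilon> k) (z k) (z (Suc k)) \<and> \<tau> (Suc k) = \<sigma>2 * \<tau> k)"

definition accumulation_point :: "(nat \<Rightarrow> 'a::topological_space) \<Rightarrow> 'a \<Rightarrow> bool"
  where "accumulation_point x l \<longleftrightarrow> (\<exists>r. strict_mono r \<and> (x \<circ> r) \<longlonglongrightarrow> l)"

end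

theory Submission
  imports Defs
begin

text \<open>
  Everything in (P) is affine in \<open>v\<close> apart from the complementarity products. Two facts carry the
  proof.

  First, C-stationarity has a simple sufficient condition. Write \<open>c = 1/(K m\<^sub>1)\<close>. The objective only
  sees \<open>\<zeta>\<close>, the pair with \<open>H\<close>-part \<open>\<zeta>\<^sub>p\<close> has \<open>\<nabla>H = e\<^sub>p\<close>, and the pair with \<open>G\<close>-part \<open>1 - \<zeta>\<^sub>p\<close> has
  \<open>\<nabla>G = - e\<^sub>p\<close>. If every \<open>\<zeta>\<^sub>p\<close> is \<open>0\<close> or \<open>1\<close>, each entry \<open>c\<close> of \<open>\<nabla>f\<close> can therefore be cancelled by a
  single multiplier on whichever of these two constraints is active, and all other multipliers
  can be \<open>0\<close> (lemma \<open>feasible_binary_zeta_C_stationary\<close>). It remains to show that the limit is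
  feasible, which is a matter of passing to the limit, and that no \<open>\<zeta>\<^sub>p\<close> tends to a value strictly
  between \<open>0\<close> and \<open>1\<close>.

  Second, for affine data the multipliers of the relaxed products satisfy \<open>\<tau> \<lambda>\<^sup>G\<^sup>H \<rightarrow> 0\<close>
  (lemma \<open>relaxed_affine_multipliers_vanish\<close>). Pair the stationarity condition at \<open>v\<^sup>k\<close> with
  \<open>v\<^sup>k - v\<^sup>*\<close>. The objective contributes \<open>o(1)\<close>; a product with \<open>G H \<approx> \<tau>\<close> contributes at least about
  \<open>\<lambda>\<^sup>G\<^sup>H \<tau> / 2\<close>, because one of \<open>G\<close>, \<open>H\<close> vanishes at \<open>v\<^sup>*\<close>; and a sign constraint with multiplier above \<open>\<epsilon>\<close>
  is within \<open>\<epsilon>\<close> of being active, so it offsets at most \<open>\<epsilon>\<close> times its multiplier. These last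
  multipliers may be arbitrarily large, but a conic Caratheodory argument
  (lemma \<open>conic_combination_support_bound\<close>) exchanges them for multipliers with the same gradient
  combination and with sum \<open>O(1 + \<Sum>\<lambda>\<^sup>G\<^sup>H)\<close>. Since \<open>\<epsilon> = O(\<tau>\<^sup>2) = o(\<tau>)\<close>, their contribution is absorbed.

  The two facts meet in the \<open>\<zeta>\<^sub>p\<close>-row of the stationarity condition (lemma \<open>relaxed_kkt_limit\<close>).
  If \<open>\<zeta>\<^sub>p\<close> tends to a value in \<open>(0, 1)\<close>, the multiplier of \<open>\<zeta>\<^sub>p \<ge> 0\<close> is at most \<open>\<epsilon>\<close>, and the row forces
  \<open>\<lambda>\<^sup>G\<^sup>H z\<^sub>p \<ge> c - 2\<epsilon>\<close> for the pair \<open>(z\<^sub>p, 1 - \<zeta>\<^sub>p)\<close>. As \<open>z\<^sub>p (1 - \<zeta>\<^sub>p) \<le> \<tau> + \<epsilon>\<close>, the product \<open>\<tau> \<lambda>\<^sup>G\<^sup>H\<close>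
  would stay above a positive constant.
\<close>

section \<open>Relaxed complementarity constraints with affine data\<close>

text \<open>
  Caratheodory's theorem for cones, in quantitative form: among the nonnegative representations of
  a vector whose support lies in that of \<open>\<mu>\<close>, one of minimal support uses linearly independent
  generators, and on such a family the weights depend boundedly on the vector. There are only
  finitely many independent subfamilies, so one constant serves all of them.
\<close>
lemma conic_combination_support_bound:
  fixes a :: "'i::finite \<Rightarrow> 'a::euclidean_space"
  shows "\<exists>C\<ge>0. \<forall>\<mu>. (\<forall>i. 0 \<le> \<mu> i) \<longrightarrow>
    (\<exists>\<mu>'. (\<forall>i. 0 \<le> \<mu>' i) \<and> (\<forall>i. \<mu> i = 0 \<longrightarrow> \<mu>' i = 0) \<and>
       (\<Sum>i\<in>UNIV. \<mu>' i *\<^sub>R a i) = (\<Sum>i\<in>UNIV. \<mu> i *\<^sub>R a i) \<and>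
       (\<Sum>i\<in>UNIV. \<mu>' i) \<le> C * norm (\<Sum>i\<in>UNIV. \<mu> i *\<^sub>R a i))"
proof -
  define comb :: "real ^ 'i \<Rightarrow> 'a" where "comb c = (\<Sum>i\<in>UNIV. (c $ i) *\<^sub>R a i)" for c
  have lin: "linear comb"
    unfolding comb_def by (rule linearI) (simp_all add: scaleR_left_distrib sum.distrib scaleR_sum_right)
  define indep where "indep J \<longleftrightarrow> (\<forall>c. (\<forall>i. i \<notin> J \<longrightarrow> c $ i = 0) \<longrightarrow> comb c = 0 \<longrightarrow> c = 0)" for J
  \<comment> \<open>On an independent subfamily the combination map is injective, hence bounded below.\<close>
  have "\<exists>e>0. \<forall>c. (\<forall>i. i \<notin> J \<longrightarrow> c $ i = 0) \<longrightarrow> e * norm c \<le> norm (comb c)" if "indep J" for J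
  proof -
    let ?s = "{c :: real ^ 'i. \<forall>i. i \<notin> J \<longrightarrow> c $ i = 0}"
    have sub: "subspace ?s" by (auto simp: subspace_def)
    from injective_imp_isometric[OF closed_subspace[OF sub] sub, of comb] that lin
    show ?thesis by (auto simp: indep_def linear_conv_bounded_linear)
  qed
  then obtain e where e: "\<And>J. indep J \<Longrightarrow> 0 < e J"
      "\<And>J c. indep J \<Longrightarrow> (\<forall>i. i \<notin> J \<longrightarrow> c $ i = 0) \<Longrightarrow> e J * norm c \<le> norm (comb c)"
    by metis
  define C where "C = real CARD('i) * (\<Sum>J\<in>{J. indep J}. 1 / e J)"
  have nn: "0 \<le> 1 / e J" if "J \<in> {J. indep J}" for J using e(1) that by (simp add: less_imp_le)
  have C0: "0 \<le> C" unfolding C_def by (intro mult_nonneg_nonneg sum_nonneg nn) auto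
  have "\<exists>\<mu>'. (\<forall>i. 0 \<le> \<mu>' i) \<and> (\<forall>i. \<mu> i = 0 \<longrightarrow> \<mu>' i = 0) \<and>
       (\<Sum>i\<in>UNIV. \<mu>' i *\<^sub>R a i) = (\<Sum>i\<in>UNIV. \<mu> i *\<^sub>R a i) \<and>
       (\<Sum>i\<in>UNIV. \<mu>' i) \<le> C * norm (\<Sum>i\<in>UNIV. \<mu> i *\<^sub>R a i)"
    if \<mu>: "\<forall>i. 0 \<le> \<mu> i" for \<mu> :: "'i \<Rightarrow> real"
  proof -
    define good where "good m \<longleftrightarrow> (\<forall>i. 0 \<le> m $ i) \<and> (\<forall>i. \<mu> i = 0 \<longrightarrow> m $ i = 0) \<and>
       comb m = (\<Sum>i\<in>UNIV. \<mu> i *\<^sub>R a i)" for m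
    have "good (\<chi> i. \<mu> i)" using \<mu> by (simp add: good_def comb_def)
    then obtain m where m: "good m"
      and least: "\<And>m'. good m' \<Longrightarrow> card {i. m $ i \<noteq> 0} \<le> card {i. m' $ i \<noteq> 0}"
      using ex_has_least_nat[of good _ "\<lambda>m. card {i. m $ i \<noteq> 0}"] by blast
    have ind: "indep {i. m $ i \<noteq> 0}"
    proof (rule ccontr)
      assume "\<not> ?thesis"
      then obtain c0 where c0: "\<And>i. m $ i = 0 \<Longrightarrow> c0 $ i = 0" "comb c0 = 0" "c0 \<noteq> 0"
        by (auto simp: indep_def)
      then obtain i0 where i0: "c0 $ i0 \<noteq> 0" by (metis vec_eq_iff zero_index)
      define c where "c = (if c0 $ i0 > 0 then c0 else - c0)"
      have c: "\<And>i. m $ i = 0 \<Longrightarrow> c $ i = 0" "comb c = 0" "0 < c $ i0"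
        using c0 i0 lin by (auto simp: c_def linear_neg)
      \<comment> \<open>The ratio test: the largest step along \<open>- c\<close> that keeps all weights nonnegative.\<close>
      define t where "t = Min ((\<lambda>i. m $ i / c $ i) ` {i. 0 < c $ i})"
      have ne: "(\<lambda>i. m $ i / c $ i) ` {i. 0 < c $ i} \<noteq> {}" using c by blast
      have "t \<in> (\<lambda>i. m $ i / c $ i) ` {i. 0 < c $ i}"
        unfolding t_def using ne by (intro Min_in) auto
      then obtain i1 where i1: "0 < c $ i1" "t = m $ i1 / c $ i1" by blast
      have tle: "t \<le> m $ i / c $ i" if "0 < c $ i" for i
        unfolding t_def using that by (intro Min_le) auto
      have m0: "0 \<le> m $ i" for i using m by (simp add: good_def)
      have t0: "0 \<le> t" using i1 m0 by simp
      have "0 \<le> m $ i - t * c $ i" for i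
      proof (cases "0 < c $ i")
        case True then show ?thesis using tle[of i] by (simp add: field_simps)
      next
        case False
        then have "t * c $ i \<le> 0" using t0 by (simp add: mult_nonneg_nonpos)
        then show ?thesis using m0[of i] by linarith
      qed
      moreover have "comb (m - t *\<^sub>R c) = comb m"
        using c(2) lin by (simp add: linear_diff linear_scale)
      ultimately have "good (m - t *\<^sub>R c)"
        using m c(1) by (simp add: good_def)
      moreover have "card {i. (m - t *\<^sub>R c) $ i \<noteq> 0} < card {i. m $ i \<noteq> 0}"
      proof (rule psubset_card_mono)
        have "m $ i1 \<noteq> 0" using c(1) i1(1) by force
        moreover have "(m - t *\<^sub>R c) $ i1 = 0" using i1 by simp
        moreover have "{i. (m - t *\<^sub>R c) $ i \<noteq> 0} \<subseteq> {i. m $ i \<noteq> 0}" using c(1) by auto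
        ultimately show "{i. (m - t *\<^sub>R c) $ i \<noteq> 0} \<subset> {i. m $ i \<noteq> 0}" by blast
      qed simp
      ultimately show False using least by (meson not_less)
    qed
    let ?J = "{i. m $ i \<noteq> 0}"
    have "norm m \<le> 1 / e ?J * norm (comb m)"
      using e(1)[OF ind] e(2)[OF ind, of m] by (simp add: field_simps)
    also have "\<dots> \<le> (\<Sum>J\<in>{J. indep J}. 1 / e J) * norm (comb m)"
      using ind nn by (intro mult_right_mono member_le_sum) auto
    finally have nm: "norm m \<le> (\<Sum>J\<in>{J. indep J}. 1 / e J) * norm (comb m)" .
    have "(\<Sum>i\<in>UNIV. m $ i) \<le> (\<Sum>i\<in>(UNIV::'i set). norm m)"
      by (intro sum_mono) (metis component_le_norm_cart abs_le_D1)
    also have "\<dots> \<le> C * norm (comb m)"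
      using mult_left_mono[OF nm, of "real CARD('i)"] by (simp add: C_def mult.assoc)
    finally show ?thesis using m unfolding good_def comb_def
      by (intro exI[of _ "\<lambda>i. m $ i"]) auto
  qed
  then show ?thesis using C0 by blast
qed

text \<open>
  The setting is an abstract complementarity problem with affine sign constraints \<open>\<phi>\<close> and affine
  pairs \<open>(G, H)\<close>; \<open>\<mu>\<close> are the multipliers of the sign constraints and \<open>y\<close> those of the relaxed
  products \<open>G H \<le> \<tau>\<close>. By affinity, pairing the stationarity condition with \<open>x\<^sub>k - x\<^sub>0\<close> turns
  gradients into exact differences of constraint values, which are compared with \<open>\<tau> y\<close>. The
  constants below are: \<open>R\<close> bounds the product gradients, \<open>E \<epsilon>\<close> the stationarity residual after all
  multipliers of size at most \<open>\<epsilon>\<close> have been moved into it, and \<open>Y\<close> sums the remaining product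
  multipliers.
\<close>
lemma relaxed_affine_multipliers_vanish:
  fixes xs :: "nat \<Rightarrow> 'a::euclidean_space"
    and \<phi> :: "'j::finite \<Rightarrow> 'a \<Rightarrow> real" and a :: "'j \<Rightarrow> 'a"
    and G H :: "'c::finite \<Rightarrow> 'a \<Rightarrow> real" and gG gH :: "'c \<Rightarrow> 'a"
    and \<mu> :: "nat \<Rightarrow> 'j \<Rightarrow> real" and y :: "nat \<Rightarrow> 'c \<Rightarrow> real"
  assumes aff: "\<And>j x x'. \<phi> j x = \<phi> j x' + a j \<bullet> (x - x')"
      "\<And>i x x'. G i x = G i x' + gG i \<bullet> (x - x')"
      "\<And>i x x'. H i x = H i x' + gH i \<bullet> (x - x')"
    and lim: "xs \<longlonglongrightarrow> x0"
    and feas0: "\<And>j. 0 \<le> \<phi> j x0" "\<And>i. G i x0 * H i x0 = 0"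
    and feas: "\<And>k i. 0 \<le> G i (xs k)" "\<And>k i. 0 \<le> H i (xs k)"
    and sgn: "\<And>k j. 0 \<le> \<mu> k j" "\<And>k i. 0 \<le> y k i"
    and stat: "\<And>k. norm (c - (\<Sum>j\<in>UNIV. \<mu> k j *\<^sub>R a j)
        + (\<Sum>i\<in>UNIV. y k i *\<^sub>R (G i (xs k) *\<^sub>R gH i + H i (xs k) *\<^sub>R gG i))) \<le> D * \<epsilon> k"
    and comp: "\<And>k j. \<mu> k j \<le> \<epsilon> k \<or> \<phi> j (xs k) \<le> \<epsilon> k"
      "\<And>k i. y k i \<le> \<epsilon> k \<or> \<tau> k - 2 * \<epsilon> k \<le> G i (xs k) * H i (xs k)"
    and tau: "\<And>k. 0 < \<tau> k" "\<tau> \<longlonglongrightarrow> 0"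
    and eps: "\<And>k. 0 \<le> \<epsilon> k" "(\<lambda>k. \<epsilon> k / \<tau> k) \<longlonglongrightarrow> 0"
  shows "(\<lambda>k. \<tau> k * y k i) \<longlonglongrightarrow> 0"
proof -
  obtain C where C: "0 \<le> C" and red: "\<And>\<mu>. (\<forall>i. 0 \<le> \<mu> i) \<Longrightarrow>
    \<exists>\<mu>'. (\<forall>i. 0 \<le> \<mu>' i) \<and> (\<forall>i. \<mu> i = 0 \<longrightarrow> \<mu>' i = 0) \<and>
       (\<Sum>i\<in>UNIV. \<mu>' i *\<^sub>R a i) = (\<Sum>i\<in>UNIV. \<mu> i *\<^sub>R a i) \<and>
       (\<Sum>i\<in>UNIV. \<mu>' i) \<le> C * norm (\<Sum>i\<in>UNIV. \<mu> i *\<^sub>R a i)"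
    using conic_combination_support_bound[of a] by blast
  have eps0: "\<epsilon> \<longlonglongrightarrow> 0"
    using tendsto_mult[OF eps(2) tau(2)] less_imp_neq[OF tau(1)] by simp
  have limG: "(\<lambda>k. G i (xs k)) \<longlonglongrightarrow> G i x0" for i
    using tendsto_add[OF tendsto_const tendsto_inner[OF tendsto_const tendsto_diff[OF lim tendsto_const]],
        of "G i x0" "gG i" x0] by (simp add: aff(2)[of i _ x0, symmetric])
  have limH: "(\<lambda>k. H i (xs k)) \<longlonglongrightarrow> H i x0" for i
    using tendsto_add[OF tendsto_const tendsto_inner[OF tendsto_const tendsto_diff[OF lim tendsto_const]],
        of "H i x0" "gH i" x0] by (simp add: aff(3)[of i _ x0, symmetric])
  define w where "w k i = G i (xs k) *\<^sub>R gH i + H i (xs k) *\<^sub>R gG i" for k i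
  have "(\<lambda>k. \<Sum>i\<in>UNIV. norm (w k i)) \<longlonglongrightarrow> (\<Sum>i\<in>UNIV. norm (G i x0 *\<^sub>R gH i + H i x0 *\<^sub>R gG i))"
    unfolding w_def by (intro tendsto_sum tendsto_norm tendsto_add tendsto_scaleR limG limH tendsto_const)
  then have "convergent (\<lambda>k. \<Sum>i\<in>UNIV. norm (w k i))" by (rule convergentI)
  then obtain R where R: "\<And>k. norm (\<Sum>i\<in>UNIV. norm (w k i)) \<le> R" and R0: "0 < R"
    using BseqE[OF convergent_imp_Bseq] by metis
  have wR: "norm (w k i) \<le> R" for k i
  proof -
    have "norm (w k i) \<le> (\<Sum>i\<in>UNIV. norm (w k i))" by (rule member_le_sum) auto
    then show ?thesis using R[of k] by (simp add: sum_nonneg)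
  qed
  define E where "E = D + (\<Sum>j\<in>UNIV. norm (a j)) + real CARD('c) * R"
  define d where "d k = norm (xs k - x0)" for k
  define yS where "yS k i = (if y k i \<le> \<epsilon> k then 0 else y k i)" for k i
  define Y where "Y k = (\<Sum>i\<in>UNIV. yS k i)" for k
  have yS0: "0 \<le> yS k i" for k i using sgn(2) by (simp add: yS_def)
  have Y0: "0 \<le> Y k" for k unfolding Y_def by (intro sum_nonneg yS0)
  \<comment> \<open>The factor 3/2 makes each product term keep at least half of \<open>G H\<close> further down.\<close>
  have ev32: "\<forall>\<^sub>F k in sequentially. 2 * L \<le> 3 * f k"
    if "f \<longlonglongrightarrow> L" "\<And>k. 0 \<le> f k" for f and L :: real
  proof (cases "L = 0")
    case False
    then have L: "0 < L" using LIMSEQ_le_const[OF that(1), of 0] that(2) by force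
    then have "\<forall>\<^sub>F k in sequentially. 2 / 3 * L < f k"
      by (intro order_tendstoD(1)[OF that(1)]) simp
    then show ?thesis by eventually_elim linarith
  qed (use that in auto)
  have evG: "\<forall>\<^sub>F k in sequentially. \<forall>i. 2 * G i x0 \<le> 3 * G i (xs k)"
    using ev32[OF limG] feas by (simp add: eventually_all_finite)
  have evH: "\<forall>\<^sub>F k in sequentially. \<forall>i. 2 * H i x0 \<le> 3 * H i (xs k)"
    using ev32[OF limH] feas by (simp add: eventually_all_finite)
  have evE: "\<forall>\<^sub>F k in sequentially. \<epsilon> k / \<tau> k < 1 / (4 * (1 + C * R))"
    using C R0 by (intro order_tendstoD(2)[OF eps(2)]) (simp add: add_pos_nonneg)
  define \<beta> where "\<beta> k = 4 * (norm c * d k + E * \<epsilon> k * d k + \<epsilon> k * C * (norm c + E * \<epsilon> k))" for k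
  have main: "\<forall>\<^sub>F k in sequentially. \<tau> k * Y k \<le> \<beta> k"
    using evG evH evE
  proof eventually_elim
    case (elim k)
    define x where "x = xs k"
    define \<mu>T where "\<mu>T j = (if \<mu> k j \<le> \<epsilon> k then 0 else \<mu> k j)" for j
    define b where "b = (\<Sum>j\<in>UNIV. \<mu>T j *\<^sub>R a j)"
    define \<rho> where "\<rho> = c - b + (\<Sum>i\<in>UNIV. yS k i *\<^sub>R w k i)"
    have "\<rho> = (c - (\<Sum>j\<in>UNIV. \<mu> k j *\<^sub>R a j) + (\<Sum>i\<in>UNIV. y k i *\<^sub>R w k i))
        + ((\<Sum>j\<in>UNIV. (\<mu> k j - \<mu>T j) *\<^sub>R a j) - (\<Sum>i\<in>UNIV. (y k i - yS k i) *\<^sub>R w k i))"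
      by (simp add: \<rho>_def b_def scaleR_left_diff_distrib sum_subtractf)
    then have "norm \<rho> \<le> norm (c - (\<Sum>j\<in>UNIV. \<mu> k j *\<^sub>R a j) + (\<Sum>i\<in>UNIV. y k i *\<^sub>R w k i))
        + (norm (\<Sum>j\<in>UNIV. (\<mu> k j - \<mu>T j) *\<^sub>R a j) + norm (\<Sum>i\<in>UNIV. (y k i - yS k i) *\<^sub>R w k i))"
      by (simp only:) (intro norm_triangle_mono order_refl norm_triangle_ineq4)
    moreover have "norm (\<Sum>j\<in>UNIV. (\<mu> k j - \<mu>T j) *\<^sub>R a j) \<le> (\<Sum>j\<in>UNIV. \<epsilon> k * norm (a j))"
      using sgn(1)[of k] eps(1)[of k] by (intro sum_norm_le) (auto simp: \<mu>T_def intro!: mult_right_mono)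
    moreover have "norm (\<Sum>i\<in>UNIV. (y k i - yS k i) *\<^sub>R w k i) \<le> (\<Sum>i\<in>(UNIV::'c set). \<epsilon> k * R)"
      using sgn(2)[of k] eps(1)[of k] wR[of k] R0 by (intro sum_norm_le) (auto simp: yS_def intro!: mult_mono)
    moreover have "E * \<epsilon> k = D * \<epsilon> k + (\<Sum>j\<in>UNIV. \<epsilon> k * norm (a j)) + (\<Sum>i\<in>(UNIV::'c set). \<epsilon> k * R)"
      by (simp add: E_def algebra_simps sum_distrib_left)
    ultimately have \<rho>: "norm \<rho> \<le> E * \<epsilon> k"
      using stat[of k, folded w_def] by linarith
    have beq: "b = c + (\<Sum>i\<in>UNIV. yS k i *\<^sub>R w k i) - \<rho>" by (simp add: \<rho>_def)
    have "norm (\<Sum>i\<in>UNIV. yS k i *\<^sub>R w k i) \<le> (\<Sum>i\<in>UNIV. yS k i * R)"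
      using yS0[of k] wR[of k] by (intro sum_norm_le) (auto intro!: mult_left_mono)
    also have "\<dots> = R * Y k" by (simp add: Y_def sum_distrib_left mult.commute)
    finally have nS: "norm (\<Sum>i\<in>UNIV. yS k i *\<^sub>R w k i) \<le> R * Y k" .
    have nb: "norm b \<le> norm c + R * Y k + E * \<epsilon> k"
      using norm_triangle_ineq4[of "c + (\<Sum>i\<in>UNIV. yS k i *\<^sub>R w k i)" \<rho>]
        norm_triangle_ineq[of c "\<Sum>i\<in>UNIV. yS k i *\<^sub>R w k i"] nS \<rho>
      unfolding beq by linarith
    \<comment> \<open>Exchange the multipliers \<open>\<mu>T\<close>, whose size is unknown, for \<open>\<mu>'\<close> controlled by \<open>norm b\<close>.\<close>
    have "\<forall>j. 0 \<le> \<mu>T j" using sgn(1)[of k] by (simp add: \<mu>T_def)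
    from red[OF this, folded b_def] obtain \<mu>' where \<mu>': "\<And>j. 0 \<le> \<mu>' j" "\<And>j. \<mu>T j = 0 \<Longrightarrow> \<mu>' j = 0"
        "(\<Sum>j\<in>UNIV. \<mu>' j *\<^sub>R a j) = b" "(\<Sum>j\<in>UNIV. \<mu>' j) \<le> C * norm b"
      by blast
    have "b \<bullet> (x - x0) = (\<Sum>j\<in>UNIV. \<mu>' j * (\<phi> j x - \<phi> j x0))"
      using aff(1)[of _ x x0] by (simp add: \<mu>'(3)[symmetric] inner_sum_left)
    also have "\<dots> \<le> (\<Sum>j\<in>UNIV. \<mu>' j * \<epsilon> k)"
    proof (rule sum_mono)
      fix j
      show "\<mu>' j * (\<phi> j x - \<phi> j x0) \<le> \<mu>' j * \<epsilon> k"
      proof (cases "\<mu>T j = 0")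
        case False
        then have "\<phi> j x \<le> \<epsilon> k" using comp(1)[of k j] by (auto simp: \<mu>T_def x_def split: if_splits)
        then show ?thesis using feas0(1)[of j] \<mu>'(1)[of j] by (intro mult_left_mono) auto
      qed (simp add: \<mu>'(2))
    qed
    also have "\<dots> \<le> C * (norm c + R * Y k + E * \<epsilon> k) * \<epsilon> k"
      unfolding sum_distrib_right[symmetric]
      using \<mu>'(4) mult_left_mono[OF nb C] eps(1)[of k] by (intro mult_right_mono) auto
    finally have up: "b \<bullet> (x - x0) \<le> C * (norm c + R * Y k + E * \<epsilon> k) * \<epsilon> k" .
    have "Y k * ((\<tau> k - 2 * \<epsilon> k) / 2) \<le> (\<Sum>i\<in>UNIV. yS k i * (w k i \<bullet> (x - x0)))"
      unfolding Y_def sum_distrib_right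
    proof (rule sum_mono)
      fix i
      show "yS k i * ((\<tau> k - 2 * \<epsilon> k) / 2) \<le> yS k i * (w k i \<bullet> (x - x0))"
      proof (cases "y k i \<le> \<epsilon> k")
        case False
        then have GH: "\<tau> k - 2 * \<epsilon> k \<le> G i x * H i x" using comp(2)[of k i] by (auto simp: x_def)
        have wi: "w k i \<bullet> (x - x0) = G i x * (H i x - H i x0) + H i x * (G i x - G i x0)"
          using aff(2)[of i x x0] aff(3)[of i x x0] by (simp add: w_def x_def inner_left_distrib)
        have pos: "0 \<le> G i x" "0 \<le> H i x" "2 * G i x0 \<le> 3 * G i x" "2 * H i x0 \<le> 3 * H i x"
          using feas elim by (auto simp: x_def)
        \<comment> \<open>Only one of the factors can be nonzero at \<open>x0\<close>, and there it is at most 3/2 of its current value.\<close>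
        have "G i x * H i x / 2 \<le> w k i \<bullet> (x - x0)"
        proof (cases "H i x0 = 0")
          case True
          then show ?thesis unfolding wi using mult_left_mono[OF pos(3,2)] by (simp add: algebra_simps)
        next
          case False
          then have "G i x0 = 0" using feas0(2)[of i] by simp
          then show ?thesis unfolding wi using mult_left_mono[OF pos(4,1)] by (simp add: algebra_simps)
        qed
        then show ?thesis using GH yS0 by (intro mult_left_mono) auto
      qed (simp add: yS_def)
    qed
    moreover have "b \<bullet> (x - x0) = c \<bullet> (x - x0) + (\<Sum>i\<in>UNIV. yS k i * (w k i \<bullet> (x - x0))) - \<rho> \<bullet> (x - x0)"
      by (simp add: beq inner_left_distrib inner_diff_left inner_sum_left)
    moreover have "- (norm c * d k) \<le> c \<bullet> (x - x0)"
      using Cauchy_Schwarz_ineq2[of c "x - x0"] by (simp add: d_def x_def abs_le_iff)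
    moreover have "\<rho> \<bullet> (x - x0) \<le> E * \<epsilon> k * d k"
      using Cauchy_Schwarz_ineq2[of \<rho> "x - x0"] mult_right_mono[OF \<rho>, of "d k"]
      by (simp add: d_def x_def abs_le_iff)
    ultimately have "Y k * ((\<tau> k - 2 * \<epsilon> k) / 2)
        \<le> C * (norm c + R * Y k + E * \<epsilon> k) * \<epsilon> k + norm c * d k + E * \<epsilon> k * d k"
      using up by linarith
    then have "Y k * (2 * \<tau> k - 4 * (1 + C * R) * \<epsilon> k) \<le> \<beta> k"
      unfolding \<beta>_def by (simp add: algebra_simps)
    \<comment> \<open>This is where \<open>\<epsilon> = o(\<tau>)\<close> absorbs the terms proportional to \<open>\<epsilon> Y\<close>.\<close>
    moreover have "4 * (1 + C * R) * \<epsilon> k \<le> \<tau> k"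
    proof -
      have q: "0 < 4 * (1 + C * R)" using C R0 by (simp add: add_pos_nonneg)
      have "\<epsilon> k / \<tau> k * (4 * (1 + C * R)) < 1"
        using elim(3) q by (simp only: pos_less_divide_eq)
      then have "\<epsilon> k * (4 * (1 + C * R)) < \<tau> k"
        using tau(1)[of k] by (simp only: times_divide_eq_left divide_less_eq_1_pos)
      then show ?thesis by (simp only: mult.commute less_imp_le)
    qed
    then have "Y k * \<tau> k \<le> Y k * (2 * \<tau> k - 4 * (1 + C * R) * \<epsilon> k)"
      using Y0[of k] by (intro mult_left_mono) auto
    ultimately show ?case by (simp add: mult.commute)
  qed
  have "(\<lambda>k. d k) \<longlonglongrightarrow> 0"
    unfolding d_def using lim by (simp add: tendsto_norm_zero LIM_zero)
  then have "(\<lambda>k. 4 * (norm c * d k + E * \<epsilon> k * d k + \<epsilon> k * C * (norm c + E * \<epsilon> k)) + \<tau> k * \<epsilon> k)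
      \<longlonglongrightarrow> 4 * (norm c * 0 + E * 0 * 0 + 0 * C * (norm c + E * 0)) + 0 * 0"
    by (intro tendsto_intros eps0 tau)
  then have lim0: "(\<lambda>k. \<beta> k + \<tau> k * \<epsilon> k) \<longlonglongrightarrow> 0" by (simp add: \<beta>_def)
  show ?thesis
  proof (rule tendsto_sandwich[OF _ _ tendsto_const lim0])
    show "\<forall>\<^sub>F k in sequentially. 0 \<le> \<tau> k * y k i"
      using tau(1) sgn(2) by (simp add: less_imp_le)
    show "\<forall>\<^sub>F k in sequentially. \<tau> k * y k i \<le> \<beta> k + \<tau> k * \<epsilon> k"
      using main
    proof eventually_elim
      case (elim k)
      have "yS k i \<le> Y k" unfolding Y_def by (rule member_le_sum) (auto intro: yS0)
      then have "y k i \<le> Y k + \<epsilon> k" using eps(1)[of k] Y0[of k] by (auto simp: yS_def split: if_splits)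
      then have "\<tau> k * y k i \<le> \<tau> k * (Y k + \<epsilon> k)" using tau(1)[of k] by (intro mult_left_mono) auto
      then show ?case using elim by (simp add: distrib_left)
    qed
  qed
qed

section \<open>Gradients of affine functions\<close>

lemma grad_eqI: "GDERIV \<phi> x :> D \<Longrightarrow> grad \<phi> x = D"
proof -
  assume D: "GDERIV \<phi> x :> D"
  have "D' = D" if "GDERIV \<phi> x :> D'" for D'
  proof -
    have "(\<lambda>h. h \<bullet> D') = (\<lambda>h. h \<bullet> D)"
      using that D unfolding gderiv_def by (rule has_derivative_unique)
    then show ?thesis by (metis vector_eq_ldot inner_commute)
  qed
  with D show ?thesis unfolding grad_def by (rule the_equality)
qed

definition affine_real :: "('a::euclidean_space \<Rightarrow> real) \<Rightarrow> bool"
  where "affine_real \<phi> \<longleftrightarrow> linear (\<lambda>x. \<phi> x - \<phi> 0)"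

lemma affine_realI:
  assumes "\<And>x y. \<phi> (x + y) = \<phi> x + \<phi> y - \<phi> 0" and "\<And>r x. \<phi> (r *\<^sub>R x) = r * \<phi> x + (1 - r) * \<phi> 0"
  shows "affine_real \<phi>"
  unfolding affine_real_def by (rule linearI) (simp_all add: assms algebra_simps)

lemma affine_real_eq_inner:
  assumes "affine_real \<phi>"
  obtains D where "\<phi> = (\<lambda>x. \<phi> 0 + x \<bullet> D)" and "\<And>x. GDERIV \<phi> x :> D"
proof
  define D where "D = adjoint (\<lambda>x. \<phi> x - \<phi> 0) 1"
  show \<phi>: "\<phi> = (\<lambda>x. \<phi> 0 + x \<bullet> D)"
    using adjoint_works[OF assms[unfolded affine_real_def], of _ 1] by (simp add: D_def fun_eq_iff)
  show "GDERIV \<phi> x :> D" for x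
    unfolding gderiv_def by (subst \<phi>) (auto intro!: derivative_eq_intros)
qed

lemma affine_real_gderiv:
  assumes "affine_real \<phi>"
  shows "GDERIV \<phi> x :> grad \<phi> 0"
proof -
  obtain D where "\<And>x. GDERIV \<phi> x :> D" using affine_real_eq_inner[OF assms] by blast
  then show ?thesis using grad_eqI by metis
qed

lemma grad_affine_real: "affine_real \<phi> \<Longrightarrow> grad \<phi> x = grad \<phi> 0"
  by (rule grad_eqI, rule affine_real_gderiv)

lemma affine_real_expand:
  assumes "affine_real \<phi>"
  shows "\<phi> x = \<phi> y + grad \<phi> 0 \<bullet> (x - y)"
proof -
  obtain D where \<phi>: "\<phi> = (\<lambda>x. \<phi> 0 + x \<bullet> D)" and D: "\<And>x. GDERIV \<phi> x :> D"
    using affine_real_eq_inner[OF assms] by blast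
  have "grad \<phi> 0 = D" by (rule grad_eqI[OF D])
  then show ?thesis by (subst (1 2) \<phi>) (simp add: inner_diff_right inner_commute)
qed

lemma affine_real_convex_comb:
  assumes "affine_real \<phi>" "s + t = (1::real)"
  shows "\<phi> (s *\<^sub>R x + t *\<^sub>R y) = s * \<phi> x + t * \<phi> y"
proof -
  have s: "s = 1 - t" using assms(2) by simp
  show ?thesis
    using affine_real_expand[OF assms(1), of "s *\<^sub>R x + t *\<^sub>R y" 0]
      affine_real_expand[OF assms(1), of x 0] affine_real_expand[OF assms(1), of y 0]
    by (simp add: s algebra_simps inner_add_right inner_diff_right)
qed

lemma grad_affine_real_inner: "affine_real \<phi> \<Longrightarrow> grad \<phi> 0 \<bullet> h = \<phi> h - \<phi> 0"
  using affine_real_expand[of \<phi> h 0] by simp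

lemma tendsto_affine_real:
  assumes "affine_real \<phi>" and "(xs \<longlongrightarrow> x0) F"
  shows "((\<lambda>k. \<phi> (xs k)) \<longlongrightarrow> \<phi> x0) F"
proof -
  have "((\<lambda>k. \<phi> 0 + grad \<phi> 0 \<bullet> (xs k - 0)) \<longlongrightarrow> \<phi> 0 + grad \<phi> 0 \<bullet> (x0 - 0)) F"
    by (intro tendsto_intros assms(2))
  then show ?thesis
    by (simp only: affine_real_expand[OF assms(1), of _ 0, symmetric])
qed

section \<open>The affine data of problem (P)\<close>

lemma affine_real_fobj: "affine_real fobj"
  by (rule affine_realI) (simp_all add: fobj_def sum.distrib sum_distrib_left sum_divide_distrib algebra_simps)

lemma affine_real_gcon: "affine_real (\<lambda>x. gcon P x $ i)"
  by (rule affine_realI; cases i) (simp_all add: gcon_def algebra_simps)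

lemma affine_real_Hcon: "affine_real (\<lambda>x. Hcon x $ i)"
  by (rule affine_realI) (simp_all add: Hcon_def)

lemma affine_real_Gcon: "affine_real (\<lambda>x. Gcon P x $ i)"
  by (rule affine_realI; cases i)
     (simp_all add: Gcon_def Let_def matrix_vector_mult_def sum.distrib sum_distrib_left algebra_simps)

lemmas affine_real_data = affine_real_fobj affine_real_gcon affine_real_Hcon affine_real_Gcon

text \<open>
  The affine data have constant gradients, so evaluating them at \<open>0\<close> loses nothing and separates
  the constant vectors from the dependence on \<open>v\<close>, which sits only in the product terms.
\<close>
lemma grad_Lagr:
  "grad (\<lambda>x. Lagr P \<tau> x (lg, lG, lH, lGH)) v =
    grad fobj 0 - (\<Sum>i\<in>UNIV. lg $ i *\<^sub>R grad (\<lambda>x. gcon P x $ i) 0)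
      - (\<Sum>i\<in>UNIV. lG $ i *\<^sub>R grad (\<lambda>x. Gcon P x $ i) 0)
      - (\<Sum>i\<in>UNIV. lH $ i *\<^sub>R grad (\<lambda>x. Hcon x $ i) 0)
      + (\<Sum>i\<in>UNIV. lGH $ i *\<^sub>R (Gcon P v $ i *\<^sub>R grad (\<lambda>x. Hcon x $ i) 0
          + Hcon v $ i *\<^sub>R grad (\<lambda>x. Gcon P x $ i) 0))"
proof (rule grad_eqI)
  note d = affine_real_data[THEN affine_real_gderiv, unfolded gderiv_def]
  show "GDERIV (\<lambda>x. Lagr P \<tau> x (lg, lG, lH, lGH)) v :> (grad fobj 0
      - (\<Sum>i\<in>UNIV. lg $ i *\<^sub>R grad (\<lambda>x. gcon P x $ i) 0)
      - (\<Sum>i\<in>UNIV. lG $ i *\<^sub>R grad (\<lambda>x. Gcon P x $ i) 0)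
      - (\<Sum>i\<in>UNIV. lH $ i *\<^sub>R grad (\<lambda>x. Hcon x $ i) 0)
      + (\<Sum>i\<in>UNIV. lGH $ i *\<^sub>R (Gcon P v $ i *\<^sub>R grad (\<lambda>x. Hcon x $ i) 0
          + Hcon v $ i *\<^sub>R grad (\<lambda>x. Gcon P x $ i) 0)))"
    unfolding gderiv_def Lagr.simps
    by (rule derivative_eq_intros d refl)+
       (simp add: fun_eq_iff inner_add_right inner_diff_right inner_sum_right algebra_simps)
qed

section \<open>Iterates of GRLPN\<close>

lemma convex_Omega: "convex (Omega P)"
proof (rule convexI)
  fix z z' :: "('a, 'b, 'c, 'd) pdpoint" and s t :: real
  assume z: "z \<in> Omega P" "z' \<in> Omega P" and st: "0 \<le> s" "0 \<le> t" "s + t = 1"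
  obtain v lg lG lH lGH u where z1: "z = (v, (lg, lG, lH, lGH), u)" by (metis prod.exhaust)
  obtain v' lg' lG' lH' lGH' u' where z2: "z' = (v', (lg', lG', lH', lGH'), u')" by (metis prod.exhaust)
  show "s *\<^sub>R z + t *\<^sub>R z' \<in> Omega P"
    using z st
    by (simp add: z1 z2 Omega_def less_eq_vec_def affine_real_convex_comb[OF affine_real_gcon]
        affine_real_convex_comb[OF affine_real_Gcon] affine_real_convex_comb[OF affine_real_Hcon])
qed

text \<open>
  The Newton point \<open>z + d\<close> lies in \<open>\<Omega>\<close> by the last constraint of the linear program, and the line
  search returns a point on the segment from \<open>z\<close> to it.
\<close>
lemma inner_step_Omega:
  assumes "inner_step P \<sigma>1 \<theta> \<tau> z z'" and "z \<in> Omega P" and "0 < \<theta>" "\<theta> < 1"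
  shows "z' \<in> Omega P"
proof -
  obtain d m where d: "z + d \<in> Omega P" "z' = z + \<theta> ^ m *\<^sub>R d"
    using assms(1) unfolding inner_step_def lp_solution_def lp_feasible_def by blast
  have t: "0 \<le> \<theta> ^ m" "\<theta> ^ m \<le> 1" using assms(3,4) by (auto simp: power_le_one)
  have "(1 - \<theta> ^ m) *\<^sub>R z + \<theta> ^ m *\<^sub>R (z + d) \<in> Omega P"
    using convexD[OF convex_Omega assms(2) d(1), of "1 - \<theta> ^ m" "\<theta> ^ m"] t by simp
  moreover have "(1 - \<theta> ^ m) *\<^sub>R z + \<theta> ^ m *\<^sub>R (z + d) = z'"
    by (simp add: d(2) algebra_simps)
  ultimately show ?thesis by simp
qed

lemma inner_loop_result:
  assumes "inner_loop P \<sigma>1 \<theta> \<tau> \<epsilon> z z'" and "z \<in> Omega P" and "0 < \<theta>" "\<theta> < 1"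
  shows "z' \<in> Omega P" and "infnorm (Fmap P \<tau> z') \<le> \<epsilon>"
proof -
  obtain s N where s: "s 0 = z" "s N = z'" "infnorm (Fmap P \<tau> (s N)) \<le> \<epsilon>"
      "\<And>j. j < N \<Longrightarrow> inner_step P \<sigma>1 \<theta> \<tau> (s j) (s (Suc j))"
    using assms(1) unfolding inner_loop_def by blast
  have "j \<le> N \<Longrightarrow> s j \<in> Omega P" for j
  proof (induction j)
    case (Suc j)
    then show ?case using inner_step_Omega[OF s(4) _ assms(3,4), of j] by simp
  qed (use s(1) assms(2) in simp)
  then show "z' \<in> Omega P" "infnorm (Fmap P \<tau> z') \<le> \<epsilon>" using s by auto
qed

lemma GRLPN_iterate:
  assumes "GRLPN P \<sigma>1 \<sigma>2 \<theta> \<tau>0 \<tau> \<epsilon> z"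
  shows "z k \<in> Omega P" and "infnorm (Fmap P (\<tau> k) (z (Suc k))) \<le> \<epsilon> k"
proof -
  have g: "z 0 \<in> Omega P" "0 < \<theta>" "\<theta> < 1"
      "\<And>k. inner_loop P \<sigma>1 \<theta> (\<tau> k) (\<epsilon> k) (z k) (z (Suc k))"
    using assms by (auto simp: GRLPN_def)
  show z: "z k \<in> Omega P" for k
    by (induction k) (use g inner_loop_result(1) in blast)+
  show "infnorm (Fmap P (\<tau> k) (z (Suc k))) \<le> \<epsilon> k"
    using inner_loop_result(2)[OF g(4) z g(2,3)] .
qed

lemma infnorm_Pair:
  fixes a :: "'a::euclidean_space" and b :: "'b::euclidean_space"
  shows "infnorm a \<le> infnorm (a, b)" and "infnorm b \<le> infnorm (a, b)"
proof -
  show "infnorm a \<le> infnorm (a, b)"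
    unfolding infnorm_Max[of a]
  proof (rule Max.boundedI)
    fix r assume "r \<in> (\<lambda>i. \<bar>a \<bullet> i\<bar>) ` Basis"
    then obtain i where "i \<in> Basis" "r = \<bar>a \<bullet> i\<bar>" by blast
    then show "r \<le> infnorm (a, b)"
      using Basis_le_infnorm[of "(i, 0)" "(a, b)"] by (simp add: Basis_prod_def)
  qed auto
  show "infnorm b \<le> infnorm (a, b)"
    unfolding infnorm_Max[of b]
  proof (rule Max.boundedI)
    fix r assume "r \<in> (\<lambda>i. \<bar>b \<bullet> i\<bar>) ` Basis"
    then obtain i where "i \<in> Basis" "r = \<bar>b \<bullet> i\<bar>" by blast
    then show "r \<le> infnorm (a, b)"
      using Basis_le_infnorm[of "(0, i)" "(a, b)"] by (simp add: Basis_prod_def)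
  qed auto
qed

lemma Fmap_residual:
  fixes v :: "('k::finite, 'm1::finite, 'm2::finite, 'n::finite) var"
  assumes "infnorm (Fmap P \<tau> (v, (lg, lG, lH, lGH), u)) \<le> \<epsilon>"
  shows "infnorm (grad (\<lambda>x. Lagr P \<tau> x (lg, lG, lH, lGH)) v) \<le> \<epsilon>"
    and "\<bar>u $ i + Gcon P v $ i * Hcon v $ i - \<tau>\<bar> \<le> \<epsilon>"
    and "min (lg $ j) (gcon P v $ j) \<le> \<epsilon>"
    and "min (lG $ i) (Gcon P v $ i) \<le> \<epsilon>"
    and "min (lH $ i) (Hcon v $ i) \<le> \<epsilon>"
    and "min (lGH $ i) (u $ i) \<le> \<epsilon>"
proof -
  have a: "infnorm a \<le> \<epsilon> \<and> infnorm b \<le> \<epsilon> \<and> infnorm c \<le> \<epsilon> \<and> infnorm d \<le> \<epsilon> \<and> infnorm e \<le> \<epsilon> \<and> infnorm f \<le> \<epsilon>"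
    if "infnorm (a, b, c, d, e, f) \<le> \<epsilon>" for a :: "('k, 'm1, 'm2, 'n) var"
      and b :: "('k, 'm1, 'm2, 'n) cvec" and c :: "'n bvec"
      and d e f :: "('k, 'm1, 'm2, 'n) cvec"
    using that infnorm_Pair(1)[of a "(b, c, d, e, f)"] infnorm_Pair(2)[of "(b, c, d, e, f)" a]
      infnorm_Pair(1)[of b "(c, d, e, f)"] infnorm_Pair(2)[of "(c, d, e, f)" b]
      infnorm_Pair(1)[of c "(d, e, f)"] infnorm_Pair(2)[of "(d, e, f)" c]
      infnorm_Pair(1)[of d "(e, f)"] infnorm_Pair(2)[of "(e, f)" d]
      infnorm_Pair(1)[of e f] infnorm_Pair(2)[of f e]
    by (intro conjI) linarith+
  note b = a[OF assms[unfolded Fmap.simps]]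
  from b show "infnorm (grad (\<lambda>x. Lagr P \<tau> x (lg, lG, lH, lGH)) v) \<le> \<epsilon>" by blast
  have cmp: "\<bar>x $ i\<bar> \<le> \<epsilon>" if "infnorm x \<le> \<epsilon>" for x :: "real ^ 'i" and i
    using component_le_infnorm_cart[of x i] that by linarith
  show "\<bar>u $ i + Gcon P v $ i * Hcon v $ i - \<tau>\<bar> \<le> \<epsilon>"
    using b[THEN conjunct2, THEN conjunct1, THEN cmp, of i] by simp
  show "min (lg $ j) (gcon P v $ j) \<le> \<epsilon>"
    using b[THEN conjunct2, THEN conjunct2, THEN conjunct1, THEN cmp, of j] by simp
  show "min (lG $ i) (Gcon P v $ i) \<le> \<epsilon>"
    using b[THEN conjunct2, THEN conjunct2, THEN conjunct2, THEN conjunct1, THEN cmp, of i] by simp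
  show "min (lH $ i) (Hcon v $ i) \<le> \<epsilon>"
    using b[THEN conjunct2, THEN conjunct2, THEN conjunct2, THEN conjunct2, THEN conjunct1, THEN cmp, of i] by simp
  show "min (lGH $ i) (u $ i) \<le> \<epsilon>"
    using b[THEN conjunct2, THEN conjunct2, THEN conjunct2, THEN conjunct2, THEN conjunct2, THEN cmp, of i] by simp
qed

section \<open>The limit of relaxed KKT points\<close>

lemma sum_UNIV_sum_type:
  fixes f :: "'a::finite + 'b::finite \<Rightarrow> 'c::comm_monoid_add"
  shows "(\<Sum>x\<in>UNIV. f x) = (\<Sum>x\<in>UNIV. f (Inl x)) + (\<Sum>x\<in>UNIV. f (Inr x))"
  by (subst UNIV_Plus_UNIV[symmetric], subst sum.Plus) auto

lemma grad_zeta_component: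
  fixes P :: "('k::finite, 'm1::finite, 'm2::finite, 'n::finite) svm_data"
    and e :: "('k, 'm1, 'm2, 'n) var"
  assumes e: "e = axis (Var_H (Ix_zeta p)) 1"
  shows "grad fobj 0 \<bullet> e = 1 / (real CARD('k) * real CARD('m1))"
    and "grad (\<lambda>x. gcon P x $ j) 0 \<bullet> e = 0"
    and "grad (\<lambda>x. Hcon x $ i) 0 \<bullet> e = (if i = Ix_zeta p then 1 else 0)"
    and "grad (\<lambda>x. Gcon P x $ i) 0 \<bullet> e = (if i = Ix_z p then - 1 else 0)"
proof -
  show "grad fobj 0 \<bullet> e = 1 / (real CARD('k) * real CARD('m1))"
    unfolding grad_affine_real_inner[OF affine_real_fobj]
    by (simp add: fobj_def e axis_def)
  show "grad (\<lambda>x. gcon P x $ j) 0 \<bullet> e = 0"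
    unfolding grad_affine_real_inner[OF affine_real_gcon]
    by (cases j) (simp_all add: gcon_def e axis_def)
  show "grad (\<lambda>x. Hcon x $ i) 0 \<bullet> e = (if i = Ix_zeta p then 1 else 0)"
    unfolding grad_affine_real_inner[OF affine_real_Hcon]
    by (simp add: Hcon_def e axis_def)
  show "grad (\<lambda>x. Gcon P x $ i) 0 \<bullet> e = (if i = Ix_z p then - 1 else 0)"
    unfolding grad_affine_real_inner[OF affine_real_Gcon]
    by (cases i) (simp_all add: Gcon_def Let_def
          matrix_vector_mult_def e axis_def)
qed

text \<open>
  Here \<open>y\<close> is the multiplier \<open>\<lambda>\<^sup>G\<^sup>H\<close>. A limit \<open>\<zeta>\<^sub>p\<close> in \<open>(0, 1)\<close> would require \<open>y\<close> of order \<open>1/\<tau>\<close> for the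
  pair \<open>(z\<^sub>p, 1 - \<zeta>\<^sub>p)\<close>, whereas \<open>\<tau> y\<close> tends to \<open>0\<close>.
\<close>
lemma relaxed_kkt_limit:
  fixes P :: "('k::finite, 'm1::finite, 'm2::finite, 'n::finite) svm_data"
    and xs :: "nat \<Rightarrow> ('k, 'm1, 'm2, 'n) var"
  assumes res: "\<And>k. infnorm (Fmap P (\<tau> k) (xs k, (lg k, lG k, lH k, y k), u k)) \<le> \<epsilon> k"
    and om: "\<And>k. (xs k, (lg k, lG k, lH k, y k), u k) \<in> Omega P"
    and lim: "xs \<longlonglongrightarrow> x0"
    and tau: "\<And>k. 0 < \<tau> k" "\<tau> \<longlonglongrightarrow> 0"
    and eps: "\<And>k. 0 \<le> \<epsilon> k" "(\<lambda>k. \<epsilon> k / \<tau> k) \<longlonglongrightarrow> 0"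
  shows "feasible P x0" and "x0 $ Var_H (Ix_zeta p) \<in> {0, 1}"
proof -
  define G where "G i x = Gcon P x $ i" for i x
  define H where "H i x = Hcon x $ i" for i and x :: "('k, 'm1, 'm2, 'n) var"
  define g where "g i x = gcon P x $ i" for i x
  have aG: "affine_real (G i)" and aH: "affine_real (H i)" and ag: "affine_real (g j)" for i j
    using affine_real_gcon[of P j] affine_real_Gcon[of P i] affine_real_Hcon[of i]
    by (simp_all add: G_def[abs_def] H_def[abs_def] g_def[abs_def])
  note limG = tendsto_affine_real[OF aG lim] and limH = tendsto_affine_real[OF aH lim]
    and limg = tendsto_affine_real[OF ag lim]
  have pos: "0 \<le> lg k $ j" "0 \<le> lG k $ i" "0 \<le> lH k $ i" "0 \<le> y k $ i" "0 \<le> u k $ i"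
      "0 \<le> g j (xs k)" "0 \<le> G i (xs k)" "0 \<le> H i (xs k)" for k i j
    using om[of k] by (auto simp: Omega_def less_eq_vec_def G_def H_def g_def)
  have eps0: "\<epsilon> \<longlonglongrightarrow> 0"
    using tendsto_mult[OF eps(2) tau(2)] less_imp_neq[OF tau(1)] by simp
  note R = Fmap_residual[OF res, folded G_def H_def g_def]
  have GHle: "G i (xs k) * H i (xs k) \<le> \<tau> k + \<epsilon> k" for i k
    using R(2)[of k i] pos(5)[of k i] by linarith
  have GHge: "y k $ i \<le> \<epsilon> k \<or> \<tau> k - 2 * \<epsilon> k \<le> G i (xs k) * H i (xs k)" for i k
    using R(2)[of k i] R(6)[of k i] by linarith

  have pos0: "0 \<le> g j x0" "0 \<le> G i x0" "0 \<le> H i x0" for i j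
    by (rule LIMSEQ_le_const[OF limg] LIMSEQ_le_const[OF limG] LIMSEQ_le_const[OF limH]; use pos in blast)+
  have GH0: "G i x0 * H i x0 = 0" for i
  proof -
    have "G i x0 * H i x0 \<le> 0 + 0"
      by (rule LIMSEQ_le[OF tendsto_mult[OF limG limH] tendsto_add[OF tau(2) eps0]]) (use GHle in blast)
    then show ?thesis using mult_nonneg_nonneg[OF pos0(2,3)[of i]] by linarith
  qed
  have "Hcon x0 \<bullet> Gcon P x0 = (\<Sum>i\<in>UNIV. G i x0 * H i x0)"
    by (simp add: inner_vec_def G_def H_def mult.commute)
  then show feas: "feasible P x0"
    using pos0 unfolding feasible_def less_eq_vec_def orthogonal_def
    by (simp add: GH0) (simp add: G_def H_def g_def)

  \<comment> \<open>The bounds \<open>g \<ge> 0\<close>, \<open>G \<ge> 0\<close>, \<open>H \<ge> 0\<close> form one family of sign constraints over a sum type.\<close>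
  define \<phi> where "\<phi> = case_sum g (case_sum G H)"
  define a where "a j = grad (\<phi> j) 0" for j
  define \<mu> where "\<mu> k = case_sum (\<lambda>j. lg k $ j) (case_sum (\<lambda>i. lG k $ i) (\<lambda>i. lH k $ i))" for k
  define gG where "gG i = grad (G i) 0" for i
  define gH where "gH i = grad (H i) 0" for i
  have a\<phi>: "affine_real (\<phi> j)" for j
    unfolding \<phi>_def by (cases j; simp add: ag aG aH split: sum.split)
  have grad_eq: "grad (\<lambda>x. Lagr P (\<tau> k) x (lg k, lG k, lH k, y k)) (xs k) =
      grad fobj 0 - (\<Sum>j\<in>UNIV. \<mu> k j *\<^sub>R a j)
        + (\<Sum>i\<in>UNIV. y k $ i *\<^sub>R (G i (xs k) *\<^sub>R gH i + H i (xs k) *\<^sub>R gG i))" for k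
    unfolding grad_Lagr sum_UNIV_sum_type
    by (simp add: \<phi>_def a_def \<mu>_def gG_def gH_def G_def[abs_def] H_def[abs_def] g_def[abs_def])
  have vanish: "(\<lambda>k. \<tau> k * y k $ i) \<longlonglongrightarrow> 0" for i
  proof (rule relaxed_affine_multipliers_vanish[where y="\<lambda>k i. y k $ i" and G=G and H=H and \<phi>=\<phi>
        and a=a and gG=gG and gH=gH and \<mu>=\<mu> and xs=xs and ?x0.0=x0 and \<epsilon>=\<epsilon> and \<tau>=\<tau>
        and c="grad fobj 0" and D="sqrt (real DIM(('k, 'm1, 'm2, 'n) var))"])
    show "\<phi> j x = \<phi> j x' + a j \<bullet> (x - x')" for j x x'
      unfolding a_def by (rule affine_real_expand[OF a\<phi>])
    show "G i x = G i x' + gG i \<bullet> (x - x')" for i x x'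
      unfolding gG_def by (rule affine_real_expand[OF aG])
    show "H i x = H i x' + gH i \<bullet> (x - x')" for i x x'
      unfolding gH_def by (rule affine_real_expand[OF aH])
    show "0 \<le> \<phi> j x0" for j using pos0 by (simp add: \<phi>_def split: sum.split)
    show "0 \<le> \<mu> k j" for k j using pos by (simp add: \<mu>_def split: sum.split)
    show "\<mu> k j \<le> \<epsilon> k \<or> \<phi> j (xs k) \<le> \<epsilon> k" for k j
      using R(3-5)[of k] by (auto simp: \<phi>_def \<mu>_def min_le_iff_disj split: sum.split)
    show "norm (grad fobj 0 - (\<Sum>j\<in>UNIV. \<mu> k j *\<^sub>R a j)
        + (\<Sum>i\<in>UNIV. y k $ i *\<^sub>R (G i (xs k) *\<^sub>R gH i + H i (xs k) *\<^sub>R gG i)))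
        \<le> sqrt (real DIM(('k, 'm1, 'm2, 'n) var)) * \<epsilon> k" for k
      unfolding grad_eq[symmetric]
      by (rule order_trans[OF norm_le_infnorm mult_left_mono[OF R(1)]]) simp
  qed (use lim GH0 pos GHge tau eps in auto)

  define c where "c = 1 / (real CARD('k) * real CARD('m1))"
  define e :: "('k, 'm1, 'm2, 'n) var" where "e = axis (Var_H (Ix_zeta p)) 1"
  have c0: "0 < c" by (simp add: c_def)
  note comp = grad_zeta_component[OF e_def, folded c_def]
  \<comment> \<open>Row \<open>\<zeta>\<^sub>p\<close> of the stationarity condition; the dropped terms \<open>\<lambda>\<^sup>G\<close> and \<open>y G\<close> are nonnegative.\<close>
  have zeta_row: "y k $ Ix_z p * H (Ix_z p) (xs k) \<ge> c - lH k $ Ix_zeta p - \<epsilon> k" for k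
  proof -
    let ?L = "grad (\<lambda>x. Lagr P (\<tau> k) x (lg k, lG k, lH k, y k)) (xs k)"
    have "\<bar>?L \<bullet> e\<bar> \<le> \<epsilon> k"
      using component_le_infnorm_cart[of ?L "Var_H (Ix_zeta p)"] R(1)[of k]
      by (simp add: e_def inner_axis)
    moreover have "?L \<bullet> e = c + lG k $ Ix_z p - lH k $ Ix_zeta p
        + (y k $ Ix_zeta p * G (Ix_zeta p) (xs k) - y k $ Ix_z p * H (Ix_z p) (xs k))"
      unfolding grad_Lagr
      by (simp add: inner_diff_left inner_add_left inner_sum_left comp sum.distrib distrib_left
          G_def H_def if_distrib[where f="\<lambda>t. _ * t"] cong: if_cong)
    ultimately show ?thesis
      using pos(2)[of k "Ix_z p"] mult_nonneg_nonneg[OF pos(4,7)[where k=k and i="Ix_zeta p"]] by linarith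
  qed
  show "x0 $ Var_H (Ix_zeta p) \<in> {0, 1}"
  proof (rule ccontr)
    define \<zeta> where "\<zeta> = x0 $ Var_H (Ix_zeta p)"
    assume "x0 $ Var_H (Ix_zeta p) \<notin> {0, 1}"
    moreover have Hz: "H (Ix_zeta p) x = x $ Var_H (Ix_zeta p)" for x by (simp add: H_def Hcon_def)
    moreover have Gz: "G (Ix_z p) x = 1 - x $ Var_H (Ix_zeta p)" for x by (simp add: G_def Gcon_def Let_def)
    ultimately have \<zeta>: "0 < \<zeta>" "\<zeta> < 1"
      using pos0(3)[of "Ix_zeta p"] pos0(2)[of "Ix_z p"] by (auto simp: \<zeta>_def)
    have evH: "\<forall>\<^sub>F k in sequentially. \<epsilon> k < H (Ix_zeta p) (xs k)"
    proof -
      have "(\<lambda>k. H (Ix_zeta p) (xs k) - \<epsilon> k) \<longlonglongrightarrow> H (Ix_zeta p) x0 - 0"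
        by (intro tendsto_diff limH eps0)
      from order_tendstoD(1)[OF this, of 0] show ?thesis using \<zeta>(1) by (simp add: \<zeta>_def Hz)
    qed
    have "\<forall>\<^sub>F k in sequentially. (c - 2 * \<epsilon> k) * G (Ix_z p) (xs k) \<le> \<tau> k * y k $ Ix_z p * (1 + \<epsilon> k / \<tau> k)"
      using evH
    proof eventually_elim
      case (elim k)
      then have "lH k $ Ix_zeta p \<le> \<epsilon> k" using R(5)[of k "Ix_zeta p"] by linarith
      then have "c - 2 * \<epsilon> k \<le> y k $ Ix_z p * H (Ix_z p) (xs k)" using zeta_row[of k] by linarith
      then have "(c - 2 * \<epsilon> k) * G (Ix_z p) (xs k) \<le> y k $ Ix_z p * H (Ix_z p) (xs k) * G (Ix_z p) (xs k)"
        by (intro mult_right_mono pos)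
      also have "\<dots> \<le> y k $ Ix_z p * (\<tau> k + \<epsilon> k)"
        using mult_left_mono[OF GHle[where k=k and i="Ix_z p"] pos(4)[where k=k and i="Ix_z p"]] by (simp add: algebra_simps)
      also have "\<dots> = \<tau> k * y k $ Ix_z p * (1 + \<epsilon> k / \<tau> k)"
        using tau(1)[of k] by (simp add: field_simps)
      finally show ?case .
    qed
    moreover have "(\<lambda>k. (c - 2 * \<epsilon> k) * G (Ix_z p) (xs k)) \<longlonglongrightarrow> (c - 2 * 0) * G (Ix_z p) x0"
      by (intro tendsto_intros eps0 limG)
    moreover have "(\<lambda>k. \<tau> k * y k $ Ix_z p * (1 + \<epsilon> k / \<tau> k)) \<longlonglongrightarrow> 0 * (1 + 0)"
      by (intro tendsto_intros vanish eps)
    ultimately have "(c - 2 * 0) * G (Ix_z p) x0 \<le> 0 * (1 + 0)"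
      using tendsto_le[OF trivial_limit_sequentially] by blast
    moreover have "0 < c * G (Ix_z p) x0" using c0 \<zeta> by (simp add: Gz \<zeta>_def)
    ultimately show False by simp
  qed
qed

section \<open>C-stationarity\<close>

lemma sum_UNIV_supported_on_range:
  fixes f :: "'i::finite \<Rightarrow> 'a::comm_monoid_add" and h :: "'p::finite \<Rightarrow> 'i"
  assumes "inj h" and "\<And>i. i \<notin> range h \<Longrightarrow> f i = 0"
  shows "(\<Sum>i\<in>UNIV. f i) = (\<Sum>p\<in>UNIV. f (h p))"
proof -
  have "(\<Sum>i\<in>UNIV. f i) = (\<Sum>i\<in>range h. f i)"
    by (rule sum.mono_neutral_right) (use assms(2) in auto)
  then show ?thesis using assms(1) by (simp add: sum.reindex)
qed

text \<open>
  Where \<open>\<zeta>\<^sub>p = 0\<close> the constraint \<open>\<zeta>\<^sub>p \<ge> 0\<close> is active and takes the multiplier \<open>c\<close>; where \<open>\<zeta>\<^sub>p = 1\<close> the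
  constraint \<open>1 - \<zeta>\<^sub>p \<ge> 0\<close> is active and takes the multiplier \<open>- c\<close>. The two belong to different
  complementarity pairs, so the partner of each is \<open>0\<close> and the sign condition on biactive pairs
  holds with product \<open>0\<close>.
\<close>
lemma feasible_binary_zeta_C_stationary:
  fixes P :: "('k::finite, 'm1::finite, 'm2::finite, 'n::finite) svm_data"
  assumes feas: "feasible P v" and bin: "\<And>p. v $ Var_H (Ix_zeta p) \<in> {0, 1}"
  shows "C_stationary P v"
proof -
  define c where "c = 1 / (real CARD('k) * real CARD('m1))"
  define \<gamma> :: "('k, 'm1, 'm2, 'n) cvec" where
    "\<gamma> = (\<chi> i. case i of Ix_z p \<Rightarrow> - c * v $ Var_H (Ix_zeta p) | _ \<Rightarrow> 0)"
  define \<nu> :: "('k, 'm1, 'm2, 'n) cvec" where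
    "\<nu> = (\<chi> i. case i of Ix_zeta p \<Rightarrow> c * (1 - v $ Var_H (Ix_zeta p)) | _ \<Rightarrow> 0)"
  have gradH: "grad (\<lambda>x. Hcon x $ i) 0 \<bullet> h = h $ Var_H i" for i and h :: "('k, 'm1, 'm2, 'n) var"
    unfolding grad_affine_real_inner[OF affine_real_Hcon]
    by (simp add: Hcon_def)
  have gradG: "grad (\<lambda>x. Gcon P x $ Ix_z p) 0 \<bullet> h = - h $ Var_H (Ix_zeta p)" for p h
    unfolding grad_affine_real_inner[OF affine_real_Gcon]
    by (simp add: Gcon_def Let_def)
  have gradf: "grad fobj 0 \<bullet> h = (\<Sum>p\<in>UNIV. c * h $ Var_H (Ix_zeta p))" for h :: "('k, 'm1, 'm2, 'n) var"
    unfolding grad_affine_real_inner[OF affine_real_fobj]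
    by (simp add: fobj_def c_def sum_distrib_left)
  define \<delta> where "\<delta> = grad fobj 0 - (\<Sum>i\<in>UNIV. \<gamma> $ i *\<^sub>R grad (\<lambda>x. Gcon P x $ i) 0)
      - (\<Sum>i\<in>UNIV. \<nu> $ i *\<^sub>R grad (\<lambda>x. Hcon x $ i) 0)"
  have "\<delta> \<bullet> h = 0" for h
  proof -
    have "(\<Sum>i\<in>UNIV. \<gamma> $ i * (grad (\<lambda>x. Gcon P x $ i) 0 \<bullet> h)) =
        (\<Sum>p\<in>UNIV. \<gamma> $ Ix_z p * (grad (\<lambda>x. Gcon P x $ Ix_z p) 0 \<bullet> h))"
      by (rule sum_UNIV_supported_on_range[of Ix_z]) (auto simp: inj_def \<gamma>_def split: cix.split)
    moreover have "(\<Sum>i\<in>UNIV. \<nu> $ i * (grad (\<lambda>x. Hcon x $ i) 0 \<bullet> h)) =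
        (\<Sum>p\<in>UNIV. \<nu> $ Ix_zeta p * (grad (\<lambda>x. Hcon x $ Ix_zeta p) 0 \<bullet> h))"
      by (rule sum_UNIV_supported_on_range[of Ix_zeta]) (auto simp: inj_def \<nu>_def split: cix.split)
    moreover have "(\<Sum>p\<in>UNIV. c * h $ Var_H (Ix_zeta p)) =
        (\<Sum>p\<in>UNIV. \<gamma> $ Ix_z p * (grad (\<lambda>x. Gcon P x $ Ix_z p) 0 \<bullet> h))
        + (\<Sum>p\<in>UNIV. \<nu> $ Ix_zeta p * (grad (\<lambda>x. Hcon x $ Ix_zeta p) 0 \<bullet> h))"
      unfolding sum.distrib[symmetric] gradG gradH
      by (rule sum.cong) (simp_all add: \<gamma>_def \<nu>_def algebra_simps)
    ultimately show ?thesis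
      by (simp add: \<delta>_def inner_diff_left inner_sum_left gradf)
  qed
  then have stat: "\<delta> = 0" by (metis inner_eq_zero_iff)
  have Gz: "Gcon P v $ Ix_z p = 1 - v $ Var_H (Ix_zeta p)" for p by (simp add: Gcon_def Let_def)
  have I_H: "\<gamma> $ i = 0" if "i \<in> I_H P v" for i
  proof (cases i)
    case (Ix_z p)
    then show ?thesis using that bin[of p] by (auto simp: I_H_def \<gamma>_def Gz)
  qed (simp_all add: \<gamma>_def)
  have I_G: "\<nu> $ i = 0" if "i \<in> I_G P v" for i
  proof (cases i)
    case (Ix_zeta p)
    then show ?thesis using that bin[of p] by (auto simp: I_G_def \<nu>_def Hcon_def)
  qed (simp_all add: \<nu>_def)
  have prod: "\<gamma> $ i * \<nu> $ i = 0" for i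
    by (simp add: \<gamma>_def \<nu>_def split: cix.split)
  show ?thesis
    unfolding C_stationary_def affine_real_data[THEN grad_affine_real, where x=v]
  proof (rule conjI[OF feas], rule exI[of _ \<gamma>], rule exI[of _ \<nu>], rule exI[of _ 0], intro conjI)
    show "grad fobj 0 - (\<Sum>i\<in>UNIV. \<gamma> $ i *\<^sub>R grad (\<lambda>x. Gcon P x $ i) 0)
      - (\<Sum>i\<in>UNIV. \<nu> $ i *\<^sub>R grad (\<lambda>x. Hcon x $ i) 0)
        - (\<Sum>i\<in>UNIV. (0 :: 'n bvec) $ i *\<^sub>R grad (\<lambda>x. gcon P x $ i) 0) = 0"
      using stat unfolding \<delta>_def by simp
  qed (simp_all add: I_H I_G prod)
qed

theorem theorem4:
  fixes P :: "('k::finite, 'm1::finite, 'm2::finite, 'n::finite) svm_data"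
    and \<sigma>1 \<sigma>2 \<theta> \<tau>0 :: real
    and \<tau> \<epsilon> :: "nat \<Rightarrow> real"
    and z :: "nat \<Rightarrow> ('k, 'm1, 'm2, 'n) pdpoint"
    and v :: "nat \<Rightarrow> ('k, 'm1, 'm2, 'n) var"
    and vstar :: "('k, 'm1, 'm2, 'n) var"
  assumes "admissible_data P"
    and "\<And>k. 0 < \<tau> k" and "decseq \<tau>" and "\<tau> \<longlonglongrightarrow> 0"
    and "\<And>k. 0 < \<epsilon> k" and "decseq \<epsilon>" and "\<epsilon> \<longlonglongrightarrow> 0"
    and "\<epsilon> \<in> O(\<lambda>k. (\<tau> k)\<^sup>2)"
    and "\<And>x. feasible P x \<Longrightarrow> MPEC_MFCQ P x"
    and "GRLPN P \<sigma>1 \<sigma>2 \<theta> \<tau>0 \<tau> \<epsilon> z"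
    and "\<And>k. v k = fst (z k)"
    and "accumulation_point v vstar"
  shows "C_stationary P vstar"
proof -
  obtain r where r: "strict_mono r" "(v \<circ> r) \<longlonglongrightarrow> vstar"
    using assms(12) by (auto simp: accumulation_point_def)
  \<comment> \<open>The residual at iterate \<open>k + 1\<close> is measured with the parameters of step \<open>k\<close>, hence the shift.\<close>
  define s where "s k = r (Suc k) - 1" for k
  have Suc_s: "Suc (s k) = r (Suc k)" for k
    using strict_mono_less[OF r(1), of 0 "Suc k"] by (simp add: s_def)
  have "strict_mono s"
  proof (rule strict_monoI)
    fix i j :: nat
    assume "i < j"
    then have "Suc (s i) < Suc (s j)" unfolding Suc_s using r(1) by (simp add: strict_mono_less)
    then show "s i < s j" by simp
  qed
  then have s: "filterlim s at_top sequentially" by (rule filterlim_subseq)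
  define z' where "z' k = z (Suc (s k))" for k
  have lim: "(\<lambda>k. fst (z' k)) \<longlonglongrightarrow> vstar"
    using LIMSEQ_Suc[OF r(2)] by (simp add: z'_def Suc_s assms(11) comp_def)
  have ratio: "(\<lambda>k. \<epsilon> k / \<tau> k) \<longlonglongrightarrow> 0"
  proof -
    obtain c where c: "\<forall>\<^sub>F k in sequentially. norm (\<epsilon> k) \<le> c * norm ((\<tau> k)\<^sup>2)"
      using assms(8) by (rule landau_o.bigE)
    have up: "\<forall>\<^sub>F k in sequentially. \<epsilon> k / \<tau> k \<le> c * \<tau> k"
      using c
    proof eventually_elim
      case (elim k)
      then show ?case
        using assms(2)[of k] assms(5)[of k] by (simp add: pos_divide_le_eq power2_eq_square mult.assoc)
    qed
    have low: "\<forall>\<^sub>F k in sequentially. 0 \<le> \<epsilon> k / \<tau> k"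
      using assms(2,5) by (simp add: less_imp_le)
    show ?thesis
      by (rule tendsto_sandwich[OF low up tendsto_const tendsto_mult_right_zero[OF assms(4)]])
  qed
  define lg where "lg k = fst (fst (snd (z' k)))" for k
  define lG where "lG k = fst (snd (fst (snd (z' k))))" for k
  define lH where "lH k = fst (snd (snd (fst (snd (z' k)))))" for k
  define y where "y k = snd (snd (snd (fst (snd (z' k)))))" for k
  define u where "u k = snd (snd (z' k))" for k
  have zk: "z' k = (fst (z' k), (lg k, lG k, lH k, y k), u k)" for k
    by (simp add: lg_def lG_def lH_def y_def u_def)
  have res: "infnorm (Fmap P (\<tau> (s k)) (fst (z' k), (lg k, lG k, lH k, y k), u k)) \<le> \<epsilon> (s k)" for k
    unfolding zk[symmetric] unfolding z'_def by (rule GRLPN_iterate(2)[OF assms(10)])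
  have om: "(fst (z' k), (lg k, lG k, lH k, y k), u k) \<in> Omega P" for k
    unfolding zk[symmetric] unfolding z'_def by (rule GRLPN_iterate(1)[OF assms(10)])
  note limit = relaxed_kkt_limit[where \<tau>="\<lambda>k. \<tau> (s k)" and \<epsilon>="\<lambda>k. \<epsilon> (s k)",
      OF res om lim assms(2) filterlim_compose[OF assms(4) s] less_imp_le[OF assms(5)]
        filterlim_compose[OF ratio s]]
  show ?thesis
    by (rule feasible_binary_zeta_C_stationary[OF limit])
qed

end
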